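(* Let $N\ge 1$. Let $\mathcal{M}_{N\times N}(\{0,1\})$ be the set of all $N\times N$ matrices with entries in $\{0,1\}$, and let $\mathcal{T}_N$ be the set of pairs $(T,T')$ of Young tableaux with entries in $\{1,\dots,N\}$ such that the shape $\lambda$ of $T$ is contained in the square $(N^N)$ and $T'$ has shape $\overline{\lambda}$, the complementary partition of $\lambda$ within $N\times N$. For $M\in\mathcal{M}_{N\times N}(\{0,1\})$ let $(T_1,T_2)$ be the pair of Young tableaux of conjugated shapes obtained by applying Knuth's bijection to $M$, let $\overline{T_2}$ be the tableau obtained from $T_2$ by column complementation within $\{1,\dots,N\}$, and set $\Phi(M)=(T_1,\overline{T_2})$. Then $\Phi$ is a bijection from $\mathcal{M}_{N\times N}(\{0,1\})$ onto $\mathcal{T}_N$; in particular the cardinality of $\mathcal{T}_N$ is $2^{N^2}$.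
   Context: Partitions are identified with their Ferrers diagrams, drawn with the longest row at the bottom (rows are counted from the bottom, columns from the left; all columns start at the bottom). A Young tableau of shape $\lambda$ is a filling of the diagram of $\lambda$ with positive integers, weakly increasing from left to right along rows and strictly increasing from bottom to top along columns. The empty partition and empty tableau are allowed. The conjugate of a partition is the partition of column heights of its diagram. Complementary partition: if $\lambda\subseteq (N^N)$ has row lengths $\ell_1\ge\ell_2\ge\dots\ge\ell_N\ge 0$ (padded by zeros), let $\nu$ be the partition with parts $N-\ell_N\ge\dots\ge N-\ell_1$; then $\overline{\lambda}$ is the conjugate of $\nu$. Equivalently, the $i$-th column of $\overline{\lambda}$ has height $N-\ell_{N-i+1}$. Column bumping of a positive integer $x$ into a Young tableau: if $x$ is strictly larger than all entries of the first column, put $x$ in a new box at the top of the first column. Otherwise replace by $x$ the smallest entry of the first column that is $\ge x$, and insert the bumped entry in the same way into the second column, and so on, until the bumped entry is placed at the top of a column (possibly a new, empty column). Knuth's bijection: given $M\in\mathcal{M}_{N\times N}(\{0,1\})$, list the pairs $(u,v)$ with $M_{u,v}=1$ in lexicographic order as $(u_1,v_1),\dots,(u_r,v_r)$. Column bump $v_1,v_2,\dots,v_r$ successively, starting with the empty tableau; the result is $T_1$. The tableau $T_2$ has shape conjugate to that of $T_1$ and is obtained by placing, for each $k$, the integer $u_k$ in the box conjugate (transposed) to the new box created when $v_k$ was column bumped. Column complementation: for every $i\in\{1,\dots,N\}$, the $i$-th column of $\overline{T_2}$ consists, in increasing order from bottom to top, of exactly those integers of $\{1,\dots,N\}$ that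 do not appear in the $(N-i+1)$-th column of $T_2$ (a missing column of $T_2$ being regarded as empty). If $T_1$ has shape $\lambda_1$, then $\overline{T_2}$ has shape $\overline{\lambda_1}$. *)

theory Defs
  imports "HOL-Library.FuncSet"
begin

text \<open>Partitions are the weakly decreasing lists of their positive parts (the row lengths, from the
  bottom row upwards).\<close>

definition is_partition :: "nat list \<Rightarrow> bool" where
  "is_partition l \<longleftrightarrow> sorted_wrt (\<ge>) l \<and> (\<forall>p\<in>set l. 0 < p)"

definition conjugate :: "nat list \<Rightarrow> nat list" where
  "conjugate l = map (\<lambda>j. length (filter (\<lambda>p. j < p) l)) [0..<Max (insert 0 (set l))]"

definition fits_in_square :: "nat \<Rightarrow> nat list \<Rightarrow> bool" where
  "fits_in_square N l \<longleftrightarrow> length l \<le> N \<and> (\<forall>p\<in>set l. p \<le> N)"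

definition row_length :: "nat list \<Rightarrow> nat \<Rightarrow> nat" where
  "row_length l i = (if i < length l then l ! i else 0)"

text \<open>With rows counted from 0, the parts before the zeros are removed are
  \<open>N - \<ell>\<^sub>N \<ge> \<dots> \<ge> N - \<ell>\<^sub>1\<close>.\<close>

definition complementary :: "nat \<Rightarrow> nat list \<Rightarrow> nat list" where
  "complementary N l =
     conjugate (filter (\<lambda>p. p \<noteq> 0) (map (\<lambda>i. N - row_length l (N - 1 - i)) [0..<N]))"

text \<open>A filling of a diagram is the list of its (nonempty) columns, from left to right, each column
  being read from bottom to top. The entry of \<open>T\<close> in row \<open>i\<close> and column \<open>j\<close> (both counted from 0)
  is thus \<open>T ! j ! i\<close>.\<close>

type_synonym filling = "nat list list"

definition young_tableau :: "nat list \<Rightarrow> filling \<Rightarrow> bool" where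
  "young_tableau l T \<longleftrightarrow>
     is_partition l \<and> map length T = conjugate l \<and>
     (\<forall>c\<in>set T. \<forall>x\<in>set c. 0 < x) \<and>
     (\<forall>c\<in>set T. sorted_wrt (<) c) \<and>
     (\<forall>j k i. j < k \<longrightarrow> k < length T \<longrightarrow> i < length (T ! k) \<longrightarrow> T ! j ! i \<le> T ! k ! i)"

definition entries :: "filling \<Rightarrow> nat set" where
  "entries T = (\<Union>c\<in>set T. set c)"

definition tableau_pairs :: "nat \<Rightarrow> (filling \<times> filling) set" where
  "tableau_pairs N =
     {(T, T'). entries T \<subseteq> {1..N} \<and> entries T' \<subseteq> {1..N} \<and>
        (\<exists>l. fits_in_square N l \<and> young_tableau l T \<and> young_tableau (complementary N l) T')}"

definition zero_one_matrices :: "nat \<Rightarrow> (nat \<times> nat \<Rightarrow> nat) set" where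
  "zero_one_matrices N = ({1..N} \<times> {1..N}) \<rightarrow>\<^sub>E {0, 1}"

fun column_bump :: "nat \<Rightarrow> filling \<Rightarrow> filling" where
  "column_bump x [] = [[x]]"
| "column_bump x (c # cs) =
     (if \<forall>y\<in>set c. y < x then (c @ [x]) # cs
      else let y = Min {y \<in> set c. x \<le> y}
           in map (\<lambda>z. if z = y then x else z) c # column_bump y cs)"

text \<open>Boxes are pairs (row, column), counted from 0, so that \<open>prod.swap\<close> is transposition.\<close>

definition boxes :: "filling \<Rightarrow> (nat \<times> nat) set" where
  "boxes T = {(i, j). j < length T \<and> i < length (T ! j)}"

text \<open>The recording tableau is built box by box as a partial map from boxes to entries;
  \<open>columns_of\<close> turns such a map into its list of columns.\<close>

definition columns_of :: "(nat \<times> nat \<rightharpoonup> nat) \<Rightarrow> filling" where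
  "columns_of F =
     map (\<lambda>j. map (\<lambda>i. the (F (i, j))) [0..<card {i. (i, j) \<in> dom F}])
       [0..<card {j. (0, j) \<in> dom F}]"

fun knuth_step ::
  "nat \<times> nat \<Rightarrow> filling \<times> (nat \<times> nat \<rightharpoonup> nat) \<Rightarrow> filling \<times> (nat \<times> nat \<rightharpoonup> nat)" where
  "knuth_step (u, v) (T, F) =
     (let T' = column_bump v T; b = the_elem (boxes T' - boxes T)
      in (T', F(prod.swap b \<mapsto> u)))"

text \<open>\<open>List.product\<close> enumerates the pairs in lexicographic order.\<close>

definition support_pairs :: "nat \<Rightarrow> (nat \<times> nat \<Rightarrow> nat) \<Rightarrow> (nat \<times> nat) list" where
  "support_pairs N M = filter (\<lambda>p. M p = 1) (List.product [1..<Suc N] [1..<Suc N])"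

definition knuth :: "nat \<Rightarrow> (nat \<times> nat \<Rightarrow> nat) \<Rightarrow> filling \<times> filling" where
  "knuth N M = (let (T, F) = fold knuth_step (support_pairs N M) ([], Map.empty)
                in (T, columns_of F))"

definition column :: "filling \<Rightarrow> nat \<Rightarrow> nat list" where
  "column T j = (if j < length T then T ! j else [])"

text \<open>Columns counted from 0, hence \<open>N - 1 - i\<close>. Empty columns occur only on the right and are
  dropped, since fillings are lists of nonempty columns.\<close>

definition column_complement :: "nat \<Rightarrow> filling \<Rightarrow> filling" where
  "column_complement N T =
     filter (\<lambda>c. c \<noteq> [])
       (map (\<lambda>i. sorted_list_of_set ({1..N} - set (column T (N - 1 - i)))) [0..<N])"

definition Phi :: "nat \<Rightarrow> (nat \<times> nat \<Rightarrow> nat) \<Rightarrow> filling \<times> filling" where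
  "Phi N M = (let (T1, T2) = knuth N M in (T1, column_complement N T2))"

end

(* Bumping a strictly increasing word into a column is a first-in-first-out queue: letters of the
   word arrive, entries of the column are services, and the bumped letters are the departures. Hence
   the shape of the part with entries at most k of the tableau reached after the matrix rows 1,...,u
   satisfies a local growth rule in (u,k) of Fomin type. That rule is reversible on each cell.
   The final tableau and the recording tableau are the values on two sides of the grid, while the
   values on the other two sides are empty shapes, so the matrix can be read off, and conversely
   every pair of semistandard tableaux of transposed shapes extends to the whole grid. Column
   complementation reverses the dominance of the counting functions of consecutive columns together
   with the order of the columns, so it is an involution on semistandard tableaux. *)

theory Submission imports Defs begin

text \<open>No reverse bumping is defined. Everything is expressed by one family of numbers, the
  count of entries at most k in column j: its differences in k give the tableau, its growth in u the
  recording tableau. Neighbouring shapes differ by a horizontal strip (at most one box per column)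
  when k grows by one, and by a vertical strip (at most one box per row) when u grows by one. This
  makes both tableaux column strict, and it is what allows a cell to be solved backwards. A cell
  couples all columns, since the letter k+1 may be passed on through several of them; the rule
  therefore carries one bit per column boundary. Forwards, the bits are determined from left to
  right, starting with the matrix entry; backwards, from right to left, starting in far columns,
  where all heights vanish. The queue depends on the letters of a matrix row arriving in increasing
  order. The invariant over prefixes of a row records only sets of letters; the order survives as
  the bound that all earlier letters are smaller than the next one.\<close>

section \<open>Counting functions of sets of letters\<close>

definition cnt :: "nat set \<Rightarrow> nat \<Rightarrow> nat" where
  "cnt A k = card (A \<inter> {1..k})"

lemma cnt_0 [simp]: "cnt A 0 = 0"
  by (simp add: cnt_def)

lemma cnt_empty [simp]: "cnt {} k = 0"
  by (simp add: cnt_def)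

lemma cnt_Suc: "cnt A (Suc k) = cnt A k + of_bool (Suc k \<in> A)"
proof (cases "Suc k \<in> A")
  case True
  then have "A \<inter> {1..Suc k} = insert (Suc k) (A \<inter> {1..k})" by (auto simp: le_Suc_eq)
  then show ?thesis using True by (simp add: cnt_def)
next
  case False
  then have "A \<inter> {1..Suc k} = A \<inter> {1..k}" by (auto simp: le_Suc_eq)
  then show ?thesis using False by (simp add: cnt_def)
qed

lemma cnt_eq_card: "A \<subseteq> {1..N} \<Longrightarrow> N \<le> k \<Longrightarrow> cnt A k = card A"
  unfolding cnt_def by (rule arg_cong[of _ _ card]) auto

lemma cnt_mono: "k \<le> l \<Longrightarrow> cnt A k \<le> cnt A l"
  unfolding cnt_def by (rule card_mono) auto

lemma cnt_complement: "k \<le> N \<Longrightarrow> cnt ({1..N} - A) k = k - cnt A k"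
proof -
  assume "k \<le> N"
  then have "({1..N} - A) \<inter> {1..k} = {1..k} - A \<inter> {1..k}" by auto
  then show ?thesis by (simp add: cnt_def card_Diff_subset)
qed

lemma cnt_inject:
  assumes "A \<subseteq> {1..N}" "B \<subseteq> {1..N}" "\<And>k. k \<le> N \<Longrightarrow> cnt A k = cnt B k"
  shows "A = B"
proof -
  have "x \<in> A \<longleftrightarrow> x \<in> B" if x: "x \<in> {1..N}" for x
  proof -
    obtain k where k: "x = Suc k"
      using x by (cases x) auto
    then have "of_bool (x \<in> A) = (of_bool (x \<in> B) :: nat)"
      using assms(3)[of k] assms(3)[of x] x cnt_Suc[of A k] cnt_Suc[of B k] by simp
    then show ?thesis by (auto simp: of_bool_def split: if_splits)
  qed
  then show ?thesis using assms(1,2) by blast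
qed

lemma mem_initial_segment_iff:
  fixes S :: "nat set"
  assumes "finite S" "\<And>i j. j \<in> S \<Longrightarrow> i < j \<Longrightarrow> i \<in> S"
  shows "x \<in> S \<longleftrightarrow> x < card S"
proof
  assume "x \<in> S"
  then have "{..x} \<subseteq> S" using assms(2) by (auto simp: le_less)
  then have "card {..x} \<le> card S" using assms(1) by (rule card_mono[rotated])
  then show "x < card S" by simp
next
  assume *: "x < card S"
  show "x \<in> S"
  proof (rule ccontr)
    assume "x \<notin> S"
    then have "S \<subseteq> {..<x}" using assms(2) by (metis lessThan_iff not_less_iff_gr_or_eq subsetI)
    then have "card S \<le> card {..<x}" by (intro card_mono) auto
    then show False using * by simp
  qed
qed

text \<open>The bridge between a column as a list and its counting function: positions with entries
  at most \<open>k\<close> form an initial segment, whose length is the count.\<close>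

lemma nth_le_iff_less_cnt:
  assumes "sorted_wrt (<) c" "\<forall>x\<in>set c. 0 < x" "i < length c"
  shows "c ! i \<le> k \<longleftrightarrow> i < cnt (set c) k"
proof -
  let ?S = "{i. i < length c \<and> c ! i \<le> k}"
  have lt: "c ! a < c ! b" if "a < b" "b < length c" for a b
    using assms(1) that by (simp add: sorted_wrt_iff_nth_less)
  have inj: "inj_on ((!) c) ?S"
    by (rule inj_onI) (metis (mono_tags, lifting) mem_Collect_eq lt nat_neq_iff)
  have "set c \<inter> {1..k} = (!) c ` ?S"
    using assms(2) by (auto simp: in_set_conv_nth Suc_le_eq image_iff)
  then have "cnt (set c) k = card ?S"
    by (simp add: cnt_def card_image[OF inj])
  moreover have "i \<in> ?S \<longleftrightarrow> i < card ?S"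
    by (rule mem_initial_segment_iff) (use lt less_imp_le order_trans in \<open>fastforce+\<close>)
  ultimately show ?thesis using assms(3) by simp
qed

section \<open>The local rule\<close>

text \<open>Column heights around one cell of the grid: \<open>\<rho>\<close> and \<open>\<nu>\<close> count the entries at most \<open>k\<close> of a column
  before and after a row is inserted, \<open>\<mu>\<close> and \<open>\<kappa>\<close> those at most \<open>k + 1\<close>. The letter \<open>k + 1\<close> enters the
  column if \<open>a\<close> and is bumped out of it if \<open>d\<close>; the length of the queue of waiting letters is \<open>\<nu> - \<rho>\<close>.\<close>

definition cell :: "bool \<Rightarrow> bool \<Rightarrow> nat \<Rightarrow> nat \<Rightarrow> nat \<Rightarrow> nat \<Rightarrow> bool" where
  "cell a d \<rho> \<mu> \<nu> \<kappa> \<longleftrightarrow> \<rho> \<le> \<nu> \<and>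
     (if a then \<kappa> = Suc \<nu> \<and> \<mu> = \<rho> + of_bool d
      else if d then \<mu> = Suc \<rho> \<and> \<rho> < \<nu> \<and> \<kappa> = \<nu>
      else \<mu> = Suc \<rho> \<and> \<nu> = \<rho> \<and> \<kappa> = \<mu> \<or> \<mu> = \<rho> \<and> \<kappa> = \<nu>)"

lemma cell_forward_unique:
  "cell a d \<rho> \<mu> \<nu> \<kappa> \<Longrightarrow> cell a d' \<rho> \<mu> \<nu> \<kappa>' \<Longrightarrow> d' = d \<and> \<kappa>' = \<kappa>"
  by (cases a; cases d; cases d') (auto simp: cell_def)

text \<open>If no letter leaves and \<open>\<kappa> = Suc \<nu>\<close>, the letter has either just
  entered or stayed from before. The conjunct \<open>\<rho> \<le> \<nu>\<close> of
  \<open>cell\<close> separates the two: \<open>\<mu> \<le> \<nu>\<close> in the first case,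
  \<open>\<mu> = \<kappa>\<close> in the second.\<close>

lemma cell_backward_unique:
  "cell a d \<rho> \<mu> \<nu> \<kappa> \<Longrightarrow> cell a' d \<rho>' \<mu> \<nu> \<kappa> \<Longrightarrow> a' = a \<and> \<rho>' = \<rho>"
  by (cases a; cases d; cases a') (auto simp: cell_def)

text \<open>The local rule of a growth diagram for dual RSK, in terms of column heights. Here
  \<open>m\<close> is the matrix entry, and the letter leaving column \<open>j\<close> is the one
  that enters column \<open>Suc j\<close>.\<close>

definition growth ::
  "(nat \<Rightarrow> nat) \<Rightarrow> (nat \<Rightarrow> nat) \<Rightarrow> (nat \<Rightarrow> nat) \<Rightarrow> bool \<Rightarrow> (nat \<Rightarrow> nat) \<Rightarrow> bool" where
  "growth \<rho> \<mu> \<nu> m \<kappa> \<longleftrightarrow>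
     (\<exists>a. a 0 = m \<and> (\<forall>j. cell (a j) (a (Suc j)) (\<rho> j) (\<mu> j) (\<nu> j) (\<kappa> j)))"

lemma growth_forward_unique:
  assumes "growth \<rho> \<mu> \<nu> m \<kappa>" "growth \<rho> \<mu> \<nu> m \<kappa>'"
  shows "\<kappa>' = \<kappa>"
proof -
  obtain a where a: "a 0 = m" "\<And>j. cell (a j) (a (Suc j)) (\<rho> j) (\<mu> j) (\<nu> j) (\<kappa> j)"
    using assms(1) by (auto simp: growth_def)
  obtain b where b: "b 0 = m" "\<And>j. cell (b j) (b (Suc j)) (\<rho> j) (\<mu> j) (\<nu> j) (\<kappa>' j)"
    using assms(2) by (auto simp: growth_def)
  have ab: "b j = a j" for j
  proof (induction j)
    case (Suc j)
    then show ?case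
      using cell_forward_unique[OF a(2)[of j], of "b (Suc j)" "\<kappa>' j"] b(2)[of j] by simp
  qed (simp add: a b)
  show ?thesis
    using cell_forward_unique[OF a(2)] b(2) unfolding ab by blast
qed

text \<open>Each column is solved from its outgoing bit, so the columns are treated from right to
  left. Beyond \<open>J\<close> no letter can enter, because entering would make
  \<open>\<kappa> j\<close> positive.\<close>

lemma growth_backward_unique:
  assumes "growth \<rho> \<mu> \<nu> m \<kappa>" "growth \<rho>' \<mu> \<nu> m' \<kappa>" and J: "\<And>j. j \<ge> J \<Longrightarrow> \<kappa> j = 0"
  shows "\<rho>' = \<rho> \<and> m' = m"
proof -
  obtain a where a: "a 0 = m" "\<And>j. cell (a j) (a (Suc j)) (\<rho> j) (\<mu> j) (\<nu> j) (\<kappa> j)"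
    using assms(1) by (auto simp: growth_def)
  obtain b where b: "b 0 = m'" "\<And>j. cell (b j) (b (Suc j)) (\<rho>' j) (\<mu> j) (\<nu> j) (\<kappa> j)"
    using assms(2) by (auto simp: growth_def)
  have J': "\<not> a j \<and> \<not> b j" if "j \<ge> J" for j
    using a(2)[of j] b(2)[of j] J[OF that] by (auto simp: cell_def split: if_splits)
  have "b (J - i) = a (J - i)" for i
  proof (induction i)
    case (Suc i)
    show ?case
    proof (cases "i < J")
      case True
      then have "J - i = Suc (J - Suc i)" by simp
      then show ?thesis
        using Suc b(2)[of "J - Suc i"]
          cell_backward_unique[OF a(2)[of "J - Suc i"], of "b (J - Suc i)" "\<rho>' (J - Suc i)"]
        by simp
    qed (use Suc in simp)
  qed (use J'[of J] in simp)
  then have ab: "b j = a j" for j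
    using J'[of j] by (metis diff_diff_cancel nat_le_linear)
  then have "\<rho>' j = \<rho> j" for j
    using cell_backward_unique[OF a(2)[of j], of "b j" "\<rho>' j"] b(2)[of j] by (simp add: ab)
  then show ?thesis using ab a(1) b(1) by auto
qed

text \<open>If the letter was in column \<open>j\<close>, then
  \<open>\<mu> j = Suc (\<rho> j)\<close> leaves room for one more box. Otherwise nothing is bumped
  into column \<open>Suc j\<close>, and \<open>\<kappa> (Suc j)\<close> is
  \<open>\<nu> (Suc j)\<close> or \<open>\<mu> (Suc j)\<close>.\<close>

lemma growth_forward_strip:
  assumes "growth \<rho> \<mu> \<nu> m \<kappa>" and \<nu>: "\<And>j. \<nu> (Suc j) \<le> \<rho> j" and \<mu>: "\<And>j. \<mu> (Suc j) \<le> \<mu> j"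
  shows "\<kappa> (Suc j) \<le> \<mu> j"
proof -
  obtain a where a: "\<And>j. cell (a j) (a (Suc j)) (\<rho> j) (\<mu> j) (\<nu> j) (\<kappa> j)"
    using assms(1) by (auto simp: growth_def)
  show ?thesis
    using a[of j] a[of "Suc j"] \<nu>[of j] \<mu>[of j]
    by (cases "a j"; cases "a (Suc j)"; cases "a (Suc (Suc j))") (auto simp: cell_def)
qed

lemma cell_mono: "cell a d \<rho> \<mu> \<nu> \<kappa> \<Longrightarrow> \<rho> \<le> \<nu> \<and> \<mu> \<le> \<kappa>"
  by (cases a; cases d) (auto simp: cell_def)

lemma growth_mono: "growth \<rho> \<mu> \<nu> m \<kappa> \<Longrightarrow> \<rho> j \<le> \<nu> j \<and> \<mu> j \<le> \<kappa> j"
  unfolding growth_def using cell_mono by blast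

text \<open>From a horizontal strip \<open>\<kappa>\<close>/\<open>\<nu>\<close> and a vertical
  strip \<open>\<kappa>\<close>/\<open>\<mu>\<close> the cell is completed. The strips
  \<open>\<mu>\<close>/\<open>\<rho>\<close> and \<open>\<nu>\<close>/\<open>\<rho>\<close> are
  returned, so that the construction can be iterated over a grid.\<close>

lemma growth_backward_exists:
  assumes c: "\<And>j. \<kappa> j = \<nu> j \<or> \<kappa> j = Suc (\<nu> j)" and le: "\<And>j. \<mu> j \<le> \<kappa> j"
    and strip: "\<And>j. \<kappa> (Suc j) \<le> \<mu> j" and \<nu>: "\<And>j. \<nu> (Suc j) \<le> \<nu> j"
  shows "\<exists>\<rho> m. growth \<rho> \<mu> \<nu> m \<kappa> \<and> (\<forall>j. \<nu> (Suc j) \<le> \<rho> j) \<and> (\<forall>j. \<mu> j = \<rho> j \<or> \<mu> j = Suc (\<rho> j))"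
proof -
  \<comment> \<open>A letter travels backwards from a column that gains a box through adjacent columns
    containing that letter.\<close>
  define a where "a j \<longleftrightarrow> (\<exists>l\<ge>j. (\<forall>i\<in>{j..l}. \<kappa> i = Suc (\<nu> i)) \<and> \<mu> l < \<kappa> l)" for j
  have a_rec: "a j \<longleftrightarrow> \<kappa> j = Suc (\<nu> j) \<and> (\<mu> j < \<kappa> j \<or> a (Suc j))" for j
  proof
    assume "a j"
    then obtain l where l: "l \<ge> j" "\<forall>i\<in>{j..l}. \<kappa> i = Suc (\<nu> i)" "\<mu> l < \<kappa> l"
      by (auto simp: a_def)
    show "\<kappa> j = Suc (\<nu> j) \<and> (\<mu> j < \<kappa> j \<or> a (Suc j))"
    proof (cases "l = j")
      case False
      then have "a (Suc j)" unfolding a_def using l by (intro exI[of _ l]) auto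
      then show ?thesis using l by auto
    qed (use l in auto)
  next
    assume R: "\<kappa> j = Suc (\<nu> j) \<and> (\<mu> j < \<kappa> j \<or> a (Suc j))"
    show "a j"
    proof (cases "\<mu> j < \<kappa> j")
      case True
      then show ?thesis unfolding a_def using R by (intro exI[of _ j]) auto
    next
      case False
      then obtain l where l: "l \<ge> Suc j" "\<forall>i\<in>{Suc j..l}. \<kappa> i = Suc (\<nu> i)" "\<mu> l < \<kappa> l"
        using R by (auto simp: a_def)
      have "\<kappa> i = Suc (\<nu> i)" if "i \<in> {j..l}" for i
        using that R l(2) by (cases "i = j") auto
      then show ?thesis unfolding a_def using l(1,3) by (intro exI[of _ l]) auto
    qed
  qed
  \<comment> \<open>The letter was in column \<open>j\<close> before iff it is bumped out of it, or
    is present afterwards although the column gained no box.\<close>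
  define \<rho> where "\<rho> j = (if a (Suc j) \<or> \<kappa> j = Suc (\<nu> j) \<and> \<kappa> j = \<mu> j then \<mu> j - 1 else \<mu> j)" for j
  \<comment> \<open>Keeps \<open>\<mu> j - 1\<close> from being truncated: a letter entering column
    \<open>Suc j\<close> makes \<open>\<kappa> (Suc j)\<close> positive, and the strip condition
    carries this over to \<open>\<mu> j\<close>.\<close>
  have pos: "0 < \<mu> j" if "a (Suc j)" for j
    using that a_rec[of "Suc j"] strip[of j] by simp
  have "cell (a j) (a (Suc j)) (\<rho> j) (\<mu> j) (\<nu> j) (\<kappa> j)" for j
    using pos[of j] a_rec[of j] c[of j] le[of j]
    by (cases "a (Suc j)"; cases "\<kappa> j = Suc (\<nu> j)"; cases "\<kappa> j = \<mu> j") (auto simp: cell_def \<rho>_def)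
  then have "growth \<rho> \<mu> \<nu> (a 0) \<kappa>" by (auto simp: growth_def)
  moreover have "\<nu> (Suc j) \<le> \<rho> j" for j
    using a_rec[of "Suc j"] strip[of j] c[of "Suc j"] \<nu>[of j] by (auto simp: \<rho>_def)
  moreover have "\<mu> j = \<rho> j \<or> \<mu> j = Suc (\<rho> j)" for j
    using pos[of j] by (auto simp: \<rho>_def)
  ultimately show ?thesis by blast
qed

section \<open>Column bumping\<close>

abbreviation entry_set :: "filling \<Rightarrow> nat \<Rightarrow> nat set" where
  "entry_set T j \<equiv> set (column T j)"

lemma column_Nil [simp]: "column [] j = []"
  by (simp add: column_def)

lemma column_Cons_0 [simp]: "column (c # cs) 0 = c"
  by (simp add: column_def)

lemma column_Cons_Suc [simp]: "column (c # cs) (Suc j) = column cs j"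
  by (simp add: column_def)

text \<open>Letters \<open>V\<close> enter the column \<open>C\<close>, which becomes \<open>C'\<close> while the letters \<open>V'\<close> are bumped.\<close>

definition transmits :: "nat set \<Rightarrow> nat set \<Rightarrow> nat set \<Rightarrow> nat set \<Rightarrow> bool" where
  "transmits V C V' C' \<longleftrightarrow>
     (\<forall>k. cell (Suc k \<in> V) (Suc k \<in> V') (cnt C k) (cnt C (Suc k)) (cnt C' k) (cnt C' (Suc k)))"

text \<open>Equal counts mean an empty queue; without further arrivals it stays empty.\<close>

lemma transmits_idle:
  assumes Q: "transmits V C V' C'" and V: "\<And>x. x \<in> V \<Longrightarrow> x < y" and eq: "cnt C y = cnt C' y"
    and "k \<ge> y"
  shows "cnt C k = cnt C' k"
  using \<open>k \<ge> y\<close>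
proof (induction k rule: dec_induct)
  case (step k)
  then have "Suc k \<notin> V" using V by force
  moreover have "cell (Suc k \<in> V) (Suc k \<in> V') (cnt C k) (cnt C (Suc k)) (cnt C' k) (cnt C' (Suc k))"
    using Q by (simp add: transmits_def)
  ultimately show ?case using step.IH by (auto simp: cell_def split: if_splits)
qed (fact eq)

lemma cnt_insert: "x > 0 \<Longrightarrow> x \<notin> A \<Longrightarrow> cnt (insert x A) k = cnt A k + of_bool (x \<le> k)"
proof (induction k)
  case (Suc k)
  then show ?case by (auto simp: cnt_Suc le_Suc_eq)
qed auto

lemma cnt_remove: "x > 0 \<Longrightarrow> x \<in> A \<Longrightarrow> cnt (A - {x}) k + of_bool (x \<le> k) = cnt A k"
  using cnt_insert[of x "A - {x}" k] by (simp add: insert_absorb)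

text \<open>The new letter is never served: from \<open>v\<close> on nothing is left in
  \<open>C'\<close>, so every entry of \<open>C\<close> there has already been bumped. The queue is
  one longer beyond \<open>v\<close>, and \<open>V'\<close> is unchanged.\<close>

lemma transmits_append:
  assumes Q: "transmits V C V' C'" and V: "\<And>x. x \<in> V \<Longrightarrow> x < v" and C': "\<And>y. y \<in> C' \<Longrightarrow> y < v"
    and v: "v > 0"
  shows "transmits (insert v V) C V' (insert v C')"
proof -
  have "v \<notin> V" "v \<notin> C'" using V C' by blast+
  have "cell (Suc k \<in> insert v V) (Suc k \<in> V') (cnt C k) (cnt C (Suc k))
      (cnt (insert v C') k) (cnt (insert v C') (Suc k))" for k
  proof -
    have c: "cell (Suc k \<in> V) (Suc k \<in> V') (cnt C k) (cnt C (Suc k)) (cnt C' k) (cnt C' (Suc k))"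
      using Q by (simp add: transmits_def)
    consider "Suc k < v" | "Suc k = v" | "k \<ge> v" by linarith
    then show ?thesis
    proof cases
      case 1
      then show ?thesis using c v \<open>v \<notin> C'\<close> by (simp add: cnt_insert)
    next
      case 2
      then have "Suc k \<notin> C'" "Suc k \<notin> V" using \<open>v \<notin> C'\<close> \<open>v \<notin> V\<close> by auto
      then show ?thesis using c 2 v \<open>v \<notin> C'\<close> cnt_Suc[of C k] cnt_Suc[of C' k]
        by (cases "Suc k \<in> V'") (auto simp: cnt_insert cell_def)
    next
      case 3
      then have "Suc k \<notin> C'" "Suc k \<notin> V" using V C' by force+
      then show ?thesis using c 3 v \<open>v \<notin> C'\<close> cnt_Suc[of C k] cnt_Suc[of C' k]
        by (cases "Suc k \<in> V'") (auto simp: cnt_insert cell_def)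
    qed
  qed
  then show ?thesis unfolding transmits_def by blast
qed

text \<open>The queue becomes longer by one between \<open>v\<close> and \<open>y\<close>, and is
  served at \<open>y\<close>. The second claim lets the argument continue in the next column, where
  \<open>y\<close> is the new largest letter.\<close>

lemma transmits_replace:
  assumes Q: "transmits V C V' C'" and V: "\<And>x. x \<in> V \<Longrightarrow> x < v"
    and y: "y \<in> C'" "v \<le> y" "\<And>z. z \<in> C' \<Longrightarrow> v \<le> z \<Longrightarrow> y \<le> z" and v: "v > 0"
  shows "transmits (insert v V) C (insert y V') (insert v (C' - {y}))"
    and "\<And>x. x \<in> V' \<Longrightarrow> x < y"
proof -
  have cell: "cell (Suc k \<in> V) (Suc k \<in> V') (cnt C k) (cnt C (Suc k)) (cnt C' k) (cnt C' (Suc k))" for k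
    using Q by (simp add: transmits_def)
  obtain y' where y': "y = Suc y'" using y(2) v by (cases y) auto
  have yV: "y \<notin> V" using V y(2) by force
  have at_y: "y \<notin> V' \<and> cnt C y' = cnt C' y' \<and> cnt C y = cnt C' y"
    using cell[of y'] y(1) yV cnt_Suc[of C' y'] unfolding y'
    by (cases "Suc y' \<in> V'") (auto simp: cell_def)
  have idle: "cnt C k = cnt C' k" if "k \<ge> y" for k
    using transmits_idle[OF Q _ _ that] V y(2) at_y less_le_trans by blast
  show "x < y" if x: "x \<in> V'" for x
  proof (rule ccontr)
    assume "\<not> x < y"
    then have "x > y" using at_y x by (metis nat_neq_iff)
    then obtain k where k: "x = Suc k" "k \<ge> y" by (cases x) auto
    have "Suc k \<notin> V" using V k y(2) by force
    then show False using cell[of k] x idle[of k] k by (auto simp: cell_def)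
  qed
  let ?D = "insert v (C' - {y})"
  \<comment> \<open>The counts rise by one exactly for \<open>v \<le> k < y\<close>. If
    \<open>v = y\<close>, the column does not change.\<close>
  have D: "cnt ?D k + of_bool (y \<le> k) = cnt C' k + of_bool (v \<le> k)" for k
  proof (cases "v = y")
    case True
    then show ?thesis using y(1) by (simp add: insert_absorb)
  next
    case False
    then have "v \<notin> C'" using y(2,3) by force
    then show ?thesis
      using cnt_insert[of v "C' - {y}" k] cnt_remove[of y C' k] v y(1,2) by simp
  qed
  have "cell (Suc k \<in> insert v V) (Suc k \<in> insert y V') (cnt C k) (cnt C (Suc k)) (cnt ?D k) (cnt ?D (Suc k))" for k
  proof -
    note c = cell[of k] D[of k] D[of "Suc k"] cnt_Suc[of C k] cnt_Suc[of C' k] y(2)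
    consider "Suc k < v" | "Suc k = v" "v = y" | "Suc k = v" "v < y" | "v \<le> k" "Suc k < y"
      | "v \<le> k" "Suc k = y" | "y \<le> k" using y(2) by linarith
    then show ?thesis
    proof cases
      case 1
      then show ?thesis using c by simp
    next
      case 2
      then have "Suc k \<in> C'" "Suc k \<notin> V" "Suc k \<notin> V'" using y(1) yV at_y by auto
      then show ?thesis using c 2 by (auto simp: cell_def)
    next
      case 3
      then have "Suc k \<notin> C'" "Suc k \<notin> V" using y(3) V by force+
      then show ?thesis using c 3 by (cases "Suc k \<in> V'") (auto simp: cell_def)
    next
      case 4
      then have "Suc k \<notin> C'" "Suc k \<notin> V" using y(3)[of "Suc k"] V[of "Suc k"] by auto
      then show ?thesis using c 4 by (cases "Suc k \<in> V'") (auto simp: cell_def)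
    next
      case 5
      then have "Suc k \<in> C'" "Suc k \<notin> V" "Suc k \<notin> V'" using y(1) yV at_y by auto
      then show ?thesis using c 5 by (auto simp: cell_def)
    next
      case 6
      then have "Suc k \<notin> V" "Suc k \<noteq> v" "Suc k \<noteq> y" using V[of "Suc k"] y(2) by auto
      then show ?thesis using c 6 by simp
    qed
  qed
  then show "transmits (insert v V) C (insert y V') ?D" unfolding transmits_def by blast
qed

text \<open>\<open>W j\<close> is the set of letters entering column \<open>j\<close>. Using
  functions on all column indices makes a new column an ordinary column that starts empty.\<close>

definition row_inserted :: "nat set \<Rightarrow> (nat \<Rightarrow> nat set) \<Rightarrow> (nat \<Rightarrow> nat set) \<Rightarrow> bool" where
  "row_inserted V f g \<longleftrightarrow> (\<exists>W. W 0 = V \<and> (\<forall>j. transmits (W j) (f j) (W (Suc j)) (g j)))"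

lemma row_inserted_iff:
  "row_inserted V f g \<longleftrightarrow>
     (\<exists>V'. transmits V (f 0) V' (g 0) \<and> row_inserted V' (\<lambda>j. f (Suc j)) (\<lambda>j. g (Suc j)))"
proof
  assume "row_inserted V f g"
  then obtain W where W: "W 0 = V" "\<And>j. transmits (W j) (f j) (W (Suc j)) (g j)"
    by (auto simp: row_inserted_def)
  have "row_inserted (W 1) (\<lambda>j. f (Suc j)) (\<lambda>j. g (Suc j))"
    unfolding row_inserted_def by (rule exI[of _ "\<lambda>j. W (Suc j)"]) (use W in auto)
  then show "\<exists>V'. transmits V (f 0) V' (g 0) \<and> row_inserted V' (\<lambda>j. f (Suc j)) (\<lambda>j. g (Suc j))"
    using W(1) W(2)[of 0] by auto
next
  assume "\<exists>V'. transmits V (f 0) V' (g 0) \<and> row_inserted V' (\<lambda>j. f (Suc j)) (\<lambda>j. g (Suc j))"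
  then obtain V' W where W: "transmits V (f 0) V' (g 0)" "W 0 = V'"
    "\<And>j. transmits (W j) (f (Suc j)) (W (Suc j)) (g (Suc j))"
    by (auto simp: row_inserted_def)
  have "transmits (case_nat V W j) (f j) (case_nat V W (Suc j)) (g j)" for j
    using W by (cases j) auto
  then show "row_inserted V f g"
    unfolding row_inserted_def by (intro exI[of _ "case_nat V W"]) auto
qed

lemma row_inserted_empty: "row_inserted {} f f"
  unfolding row_inserted_def
  by (rule exI[of _ "\<lambda>_. {}"]) (auto simp: transmits_def cell_def cnt_Suc)

lemma bumped_entry:
  fixes v :: nat
  assumes "\<not> (\<forall>y\<in>set c. y < v)"
  shows "Min {y \<in> set c. v \<le> y} \<in> set c" "v \<le> Min {y \<in> set c. v \<le> y}"
    "z \<in> set c \<Longrightarrow> v \<le> z \<Longrightarrow> Min {y \<in> set c. v \<le> y} \<le> z"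
proof -
  have "{y \<in> set c. v \<le> y} \<noteq> {}" using assms by (auto simp: not_less)
  from Min_in[OF _ this]
  show "Min {y \<in> set c. v \<le> y} \<in> set c" "v \<le> Min {y \<in> set c. v \<le> y}" by auto
qed (auto intro: Min_le)

text \<open>\<open>f\<close> stays fixed at the state before the matrix row while the letters
  accumulate in \<open>V\<close>. The bound of \<open>V\<close> by \<open>v\<close> passes to the
  next column because the bumped entry exceeds all entries bumped before.\<close>

lemma row_inserted_column_bump:
  assumes "row_inserted V f (entry_set T)" "\<And>x. x \<in> V \<Longrightarrow> x < v" "v > 0"
  shows "row_inserted (insert v V) f (entry_set (column_bump v T))"
  using assms
proof (induction v T arbitrary: V f rule: column_bump.induct)
  case (1 v)
  then obtain V' where V': "transmits V (f 0) V' {}" "row_inserted V' (\<lambda>j. f (Suc j)) (\<lambda>j. {})"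
    by (subst (asm) row_inserted_iff) auto
  have "transmits (insert v V) (f 0) V' {v}"
    using transmits_append[OF V'(1)] 1 by simp
  then show ?case
    by (subst row_inserted_iff) (use V' in auto)
next
  case (2 v c cs)
  obtain V' where V': "transmits V (f 0) V' (set c)" "row_inserted V' (\<lambda>j. f (Suc j)) (entry_set cs)"
    using 2(2) by (subst (asm) row_inserted_iff) auto
  show ?case
  proof (cases "\<forall>y\<in>set c. y < v")
    case True
    have "transmits (insert v V) (f 0) V' (insert v (set c))"
      by (rule transmits_append[OF V'(1)]) (use 2 True in auto)
    then show ?thesis using True V'
      by (subst row_inserted_iff) auto
  next
    case False
    define y where "y = Min {y \<in> set c. v \<le> y}"
    have y: "y \<in> set c" "v \<le> y" and le: "\<And>z. z \<in> set c \<Longrightarrow> v \<le> z \<Longrightarrow> y \<le> z"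
      using bumped_entry[OF False] unfolding y_def by auto
    have R: "transmits (insert v V) (f 0) (insert y V') (insert v (set c - {y}))"
      by (rule transmits_replace(1)[OF V'(1) 2(3) y le 2(4)])
    have less: "x < y" if "x \<in> V'" for x
      by (rule transmits_replace(2)[OF V'(1) 2(3) y le 2(4) that])
    have bump: "column_bump v (c # cs) = map (\<lambda>z. if z = y then v else z) c # column_bump y cs"
      using False by (simp add: y_def Let_def)
    have "row_inserted (insert y V') (\<lambda>j. f (Suc j)) (entry_set (column_bump y cs))"
      using 2(1)[OF False y_def V'(2) less] y(2) 2(4) by simp
    moreover have "set (map (\<lambda>z. if z = y then v else z) c) = insert v (set c - {y})"
      using y(1) by auto
    ultimately show ?thesis using R unfolding bump
      by (subst row_inserted_iff) auto
  qed
qed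

lemma row_inserted_fold_column_bump:
  assumes "sorted_wrt (<) vs" "\<forall>v\<in>set vs. 0 < v"
  shows "row_inserted (set vs) (entry_set T) (entry_set (fold column_bump vs T))"
  using assms
proof (induction vs rule: rev_induct)
  case (snoc v vs)
  then show ?case
    using row_inserted_column_bump[of "set vs" "entry_set T" "fold column_bump vs T" v]
    by (simp add: sorted_wrt_append)
qed (simp add: row_inserted_empty)

lemma row_inserted_growth:
  assumes "row_inserted V f g"
  shows "growth (\<lambda>j. cnt (f j) k) (\<lambda>j. cnt (f j) (Suc k)) (\<lambda>j. cnt (g j) k)
    (Suc k \<in> V) (\<lambda>j. cnt (g j) (Suc k))"
proof -
  obtain W where W: "W 0 = V" "\<And>j. transmits (W j) (f j) (W (Suc j)) (g j)"
    using assms by (auto simp: row_inserted_def)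
  then show ?thesis
    unfolding growth_def transmits_def by (intro exI[of _ "\<lambda>j. Suc k \<in> W j"]) auto
qed

section \<open>Column-strict fillings and the box created by a bump\<close>

definition columns_in :: "nat \<Rightarrow> filling \<Rightarrow> bool" where
  "columns_in N T \<longleftrightarrow> (\<forall>c\<in>set T. c \<noteq> [] \<and> sorted_wrt (<) c \<and> set c \<subseteq> {1..N})"

lemma columns_in_column_bump:
  "columns_in N T \<Longrightarrow> v \<in> {1..N} \<Longrightarrow> columns_in N (column_bump v T)"
proof (induction v T rule: column_bump.induct)
  case (2 v c cs)
  have c: "sorted_wrt (<) c" "set c \<subseteq> {1..N}" and cs: "columns_in N cs"
    using 2(2) by (auto simp: columns_in_def)
  show ?case
  proof (cases "\<forall>y\<in>set c. y < v")
    case True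
    then show ?thesis using c cs 2(3) by (auto simp: columns_in_def sorted_wrt_append)
  next
    case False
    define y where "y = Min {y \<in> set c. v \<le> y}"
    have y: "y \<in> set c" "v \<le> y" and le: "\<And>z. z \<in> set c \<Longrightarrow> v \<le> z \<Longrightarrow> y \<le> z"
      using bumped_entry[OF False] unfolding y_def by auto
    have "sorted_wrt (\<lambda>a b. (if a = y then v else a) < (if b = y then v else b)) c"
      by (rule sorted_wrt_mono_rel[OF _ c(1)]) (use y le in force)
    then have "sorted_wrt (<) (map (\<lambda>z. if z = y then v else z) c)"
      by (simp add: sorted_wrt_map)
    moreover have "set (map (\<lambda>z. if z = y then v else z) c) \<subseteq> {1..N}"
      using c(2) 2(3) by auto
    moreover have "columns_in N (column_bump y cs)"
      using 2(1)[OF False y_def cs] y(1) c(2) by auto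
    moreover have "c \<noteq> []" using y(1) by auto
    moreover have "column_bump v (c # cs) = map (\<lambda>z. if z = y then v else z) c # column_bump y cs"
      using False by (simp add: y_def Let_def)
    ultimately show ?thesis by (simp add: columns_in_def)
  qed
qed (auto simp: columns_in_def)

lemma mem_boxes_iff: "(i, j) \<in> boxes T \<longleftrightarrow> i < length (column T j)"
  by (auto simp: boxes_def column_def)

text \<open>Replacing an entry keeps the length of a column, so only the final placement creates a
  box. Hence \<open>the_elem\<close> in \<open>knuth_step\<close> is applied to a singleton.\<close>

lemma boxes_column_bump: "\<exists>b. b \<notin> boxes T \<and> boxes (column_bump v T) = insert b (boxes T)"
proof -
  have "\<exists>i l. \<not> i < length (column T l) \<and>
      (\<forall>j k. j < length (column (column_bump v T) k) \<longleftrightarrow> (j, k) = (i, l) \<or> j < length (column T k))"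
  proof (induction v T rule: column_bump.induct)
    case (1 v)
    show ?case
    proof (rule exI[of _ 0], rule exI[of _ 0], intro conjI allI)
      show "j < length (column (column_bump v []) k) \<longleftrightarrow> (j, k) = (0, 0) \<or> j < length (column [] k)" for j k
        by (cases k) auto
    qed simp
  next
    case (2 v c cs)
    show ?case
    proof (cases "\<forall>y\<in>set c. y < v")
      case True
      show ?thesis
      proof (rule exI[of _ "length c"], rule exI[of _ 0], intro conjI allI)
        show "j < length (column (column_bump v (c # cs)) k) \<longleftrightarrow>
            (j, k) = (length c, 0) \<or> j < length (column (c # cs) k)" for j k
          using True by (cases k) auto
      qed simp
    next
      case False
      obtain i l where il: "\<not> i < length (column cs l)"
        "\<And>j k. j < length (column (column_bump (Min {y \<in> set c. v \<le> y}) cs) k) \<longleftrightarrow>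
          (j, k) = (i, l) \<or> j < length (column cs k)"
        using 2(1)[OF False refl] by blast
      show ?thesis
      proof (rule exI[of _ i], rule exI[of _ "Suc l"], intro conjI allI)
        show "\<not> i < length (column (c # cs) (Suc l))"
          using il(1) by simp
        show "j < length (column (column_bump v (c # cs)) k) \<longleftrightarrow>
            (j, k) = (i, Suc l) \<or> j < length (column (c # cs) k)" for j k
          using False il(2) by (cases k) (auto simp: Let_def)
      qed
    qed
  qed
  then obtain i l where il: "\<not> i < length (column T l)"
    "\<And>j k. j < length (column (column_bump v T) k) \<longleftrightarrow> (j, k) = (i, l) \<or> j < length (column T k)"
    by blast
  show ?thesis
    by (rule exI[of _ "(i, l)"]) (use il in \<open>auto simp: mem_boxes_iff\<close>)
qed

text \<open>Weakly increasing rows amount to the dominance of counting functions (\<open>cnt_le_cnt_iff\<close> below).\<close>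

definition semistandard :: "nat \<Rightarrow> filling \<Rightarrow> bool" where
  "semistandard N T \<longleftrightarrow>
     columns_in N T \<and> (\<forall>j k. cnt (entry_set T (Suc j)) k \<le> cnt (entry_set T j) k)"

definition transposed_shapes :: "filling \<Rightarrow> filling \<Rightarrow> bool" where
  "transposed_shapes T T' \<longleftrightarrow> (\<forall>i j. j < length (column T i) \<longleftrightarrow> i < length (column T' j))"

lemma column_in_set: "column T j \<in> insert [] (set T)"
  by (simp add: column_def)

lemma columns_in_column:
  assumes "columns_in N T"
  shows "sorted_wrt (<) (column T j)" "entry_set T j \<subseteq> {1..N}"
  using assms column_in_set[of T j] by (auto simp: columns_in_def)

lemma length_column: "columns_in N T \<Longrightarrow> length (column T j) = cnt (entry_set T j) N"
  using columns_in_column[of N T j]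
  by (simp add: cnt_eq_card distinct_card strict_sorted_iff)

text \<open>Serves both for columns, padded by \<open>[]\<close>, and for row lengths, padded by
  0.\<close>

lemma padded_list_eqI:
  assumes "\<And>i. (if i < length xs then xs ! i else z) = (if i < length ys then ys ! i else z)"
    and "z \<notin> set xs" "z \<notin> set ys"
  shows "xs = ys"
proof -
  have "i < length xs \<longleftrightarrow> i < length ys" for i
    using assms(1)[of i] assms(2,3) nth_mem by (metis (full_types))
  then have "length xs = length ys" by (metis nat_neq_iff)
  then show ?thesis
    using assms(1) by (intro nth_equalityI) metis+
qed

lemma filling_eqI:
  assumes "columns_in N T" "columns_in N T'" "\<And>j. entry_set T j = entry_set T' j"
  shows "T = T'"
proof (rule padded_list_eqI)
  fix j
  have "column T j = column T' j"
    using columns_in_column[OF assms(1)] columns_in_column[OF assms(2)] assms(3)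
    by (intro strict_sorted_equal) auto
  then show "(if j < length T then T ! j else []) = (if j < length T' then T' ! j else [])"
    by (simp add: column_def)
qed (use assms(1,2) in \<open>auto simp: columns_in_def\<close>)

section \<open>The intermediate tableaux\<close>

text \<open>Free of assumptions, so that the runs of two matrices can be interpreted side by
  side.\<close>

locale knuth_run =
  fixes N :: nat and M :: "nat \<times> nat \<Rightarrow> nat"
begin

fun state :: "nat \<Rightarrow> filling \<times> (nat \<times> nat \<rightharpoonup> nat)" where
  "state 0 = ([], Map.empty)"
| "state (Suc u) =
     fold knuth_step (map (Pair (Suc u)) (filter (\<lambda>v. M (Suc u, v) = 1) [1..<Suc N])) (state u)"

definition tableau :: "nat \<Rightarrow> filling" where
  "tableau u = fst (state u)"

definition recording :: "nat \<Rightarrow> (nat \<times> nat \<rightharpoonup> nat)" where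
  "recording u = snd (state u)"

definition height :: "nat \<Rightarrow> nat \<Rightarrow> nat \<Rightarrow> nat" where
  "height u k j = cnt (entry_set (tableau u) j) k"

lemma state_eq_fold:
  "state u = fold knuth_step (filter (\<lambda>p. M p = 1) (List.product [1..<Suc u] [1..<Suc N])) ([], Map.empty)"
proof (induction u)
  case (Suc u)
  have "List.product [1..<Suc (Suc u)] [1..<Suc N] =
      List.product [1..<Suc u] [1..<Suc N] @ map (Pair (Suc u)) [1..<Suc N]"
    by (simp add: product_concat_map)
  then show ?case using Suc by (simp add: filter_map comp_def)
qed simp

lemma knuth_eq: "knuth N M = (tableau N, columns_of (recording N))"
  by (simp add: knuth_def support_pairs_def state_eq_fold tableau_def recording_def case_prod_beta)

lemma fst_fold_knuth_step: "fst (fold knuth_step (map (Pair u) vs) S) = fold column_bump vs (fst S)"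
proof (induction vs arbitrary: S)
  case (Cons v vs)
  then show ?case by (cases S) (simp add: Let_def)
qed simp

lemma tableau_Suc: "tableau (Suc u) = fold column_bump (filter (\<lambda>v. M (Suc u, v) = 1) [1..<Suc N]) (tableau u)"
  by (simp add: tableau_def fst_fold_knuth_step)

lemma tableau_0 [simp]: "tableau 0 = []"
  by (simp add: tableau_def)

lemma columns_in_tableau: "columns_in N (tableau u)"
proof (induction u)
  case (Suc u)
  have "columns_in N (fold column_bump vs T)" if "set vs \<subseteq> {1..N}" "columns_in N T" for vs T
    using that by (induction vs arbitrary: T) (auto simp: columns_in_column_bump)
  note fold = this
  show ?case unfolding tableau_Suc by (rule fold[OF _ Suc]) auto
qed (simp add: columns_in_def)

lemma height_0_left [simp]: "height 0 k = (\<lambda>j. 0)"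
  by (simp add: height_def[abs_def])

lemma height_0_right [simp]: "height u 0 = (\<lambda>j. 0)"
  by (simp add: height_def[abs_def])

lemma growth_height:
  "growth (height u k) (height u (Suc k)) (height (Suc u) k)
    (Suc k \<le> N \<and> M (Suc u, Suc k) = 1) (height (Suc u) (Suc k))"
proof -
  let ?vs = "filter (\<lambda>v. M (Suc u, v) = 1) [1..<Suc N]"
  have "row_inserted (set ?vs) (entry_set (tableau u)) (entry_set (tableau (Suc u)))"
    unfolding tableau_Suc
    by (rule row_inserted_fold_column_bump) (auto intro: sorted_wrt_filter simp del: upt_Suc)
  from row_inserted_growth[OF this, of k] show ?thesis
    by (simp add: height_def[abs_def] del: upt_Suc) (simp add: Suc_le_eq conj_commute)
qed

lemma height_mono_Suc: "height u k j \<le> height (Suc u) k j"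
  using growth_mono[OF growth_height] by blast

lemma height_mono: "u \<le> u' \<Longrightarrow> height u k j \<le> height u' k j"
  by (rule lift_Suc_mono_le[of "\<lambda>u. height u k j"]) (rule height_mono_Suc)

text \<open>The two halves feed each other: the strip and monotonicity in \<open>u\<close> make the
  next shape weakly decreasing, and this decrease is what \<open>growth_forward_strip\<close> needs
  to produce the next strip.\<close>

lemma height_decreasing_and_strip:
  "height u k (Suc j) \<le> height u k j \<and> height (Suc u) k (Suc j) \<le> height u k j"
proof (induction u arbitrary: k j)
  case 0
  show ?case
  proof (induction k arbitrary: j)
    case (Suc k)
    then show ?case using growth_forward_strip[OF growth_height[of 0 k]] by simp
  qed simp
next
  case (Suc u)
  have dec: "height (Suc u) k (Suc j) \<le> height (Suc u) k j" for k j
    using Suc[of k j] height_mono_Suc[of u k j] by linarith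
  have "height (Suc (Suc u)) k (Suc j) \<le> height (Suc u) k j"
  proof (induction k arbitrary: j)
    case (Suc k)
    then show ?case using growth_forward_strip[OF growth_height[of "Suc u" k]] dec by simp
  qed simp
  then show ?case using dec by blast
qed

lemma height_antimono: "i \<le> i' \<Longrightarrow> height u k i' \<le> height u k i"
  by (rule lift_Suc_antimono_le[of "height u k"])
    (rule height_decreasing_and_strip[THEN conjunct1])

lemma semistandard_tableau: "semistandard N (tableau u)"
  unfolding semistandard_def
  using columns_in_tableau height_decreasing_and_strip by (auto simp: height_def)

lemma boxes_tableau_iff: "(j, i) \<in> boxes (tableau u) \<longleftrightarrow> j < height u N i"
  by (simp add: mem_boxes_iff length_column[OF columns_in_tableau] height_def)

lemma height_eventually_0: "length (tableau u) \<le> i \<Longrightarrow> height u k i = 0"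
  by (simp add: height_def column_def)

section \<open>The recording tableau\<close>

text \<open>All boxes created by one matrix row get the same label, so only their set matters and
  not the order of creation.\<close>

lemma snd_fold_knuth_step:
  assumes "\<And>b. F b \<noteq> None \<longleftrightarrow> prod.swap b \<in> boxes T"
  shows "boxes T \<subseteq> boxes (fold column_bump vs T) \<and>
    snd (fold knuth_step (map (Pair u) vs) (T, F)) b =
      (if prod.swap b \<in> boxes T then F b
       else if prod.swap b \<in> boxes (fold column_bump vs T) then Some u else None)"
proof (induction vs arbitrary: b rule: rev_induct)
  case Nil
  then show ?case using assms[of b] by auto
next
  case (snoc v vs)
  obtain T' F' where S: "fold knuth_step (map (Pair u) vs) (T, F) = (T', F')"
    by force
  then have T': "T' = fold column_bump vs T"
    using fst_fold_knuth_step[of u vs "(T, F)"] by simp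
  obtain c where c: "c \<notin> boxes T'" "boxes (column_bump v T') = insert c (boxes T')"
    using boxes_column_bump by blast
  then have "the_elem (boxes (column_bump v T') - boxes T') = c"
    by (simp add: insert_Diff_if)
  then have "snd (fold knuth_step (map (Pair u) (vs @ [v])) (T, F)) = F'(prod.swap c \<mapsto> u)"
    using S by simp
  moreover have "prod.swap b = c \<longleftrightarrow> b = prod.swap c" by (cases b; cases c) auto
  ultimately show ?case
    using snoc[of b] S c by (auto simp: T'[symmetric])
qed

text \<open>The first conjunct is the invariant that \<open>snd_fold_knuth_step\<close> requires of
  its starting state.\<close>

lemma recording_iff_and_Suc:
  "(recording u b \<noteq> None \<longleftrightarrow> prod.swap b \<in> boxes (tableau u)) \<and>
   recording (Suc u) b =
      (if prod.swap b \<in> boxes (tableau u) then recording u b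
       else if prod.swap b \<in> boxes (tableau (Suc u)) then Some (Suc u) else None)"
proof (induction u arbitrary: b)
  case 0
  have "recording 0 b \<noteq> None \<longleftrightarrow> prod.swap b \<in> boxes (tableau 0)" for b
    by (simp add: recording_def boxes_def)
  then show ?case
    using snd_fold_knuth_step[of "recording 0" "tableau 0"]
    by (simp add: recording_def tableau_Suc tableau_def[of 0] del: upt_Suc)
next
  case (Suc u)
  have *: "recording (Suc u) b \<noteq> None \<longleftrightarrow> prod.swap b \<in> boxes (tableau (Suc u))" for b
  proof -
    obtain i j where b: "b = (i, j)" by force
    show ?thesis
      using Suc[of b] height_mono_Suc[of u N i] by (auto simp: b boxes_tableau_iff)
  qed
  have "(tableau (Suc u), recording (Suc u)) = state (Suc u)"
    by (simp add: tableau_def recording_def)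
  then show ?case
    using * snd_fold_knuth_step[of "recording (Suc u)" "tableau (Suc u)", OF *]
    unfolding recording_def[of "Suc (Suc u)"] tableau_Suc[of "Suc u"] state.simps(2)[of "Suc u"]
    by metis
qed

text \<open>Boxes never disappear, so a label is the first time at which its box is present. Row
  \<open>i\<close> and column \<open>j\<close> of the recording tableau are column \<open>i\<close>
  and row \<open>j\<close> of \<open>tableau\<close>.\<close>

lemma recording_eq:
  "recording n (i, j) = (if j < height n N i then Some (LEAST w. j < height w N i) else None)"
proof (induction n)
  case 0
  then show ?case using recording_iff_and_Suc[of 0 "(i, j)"] by (simp add: boxes_def)
next
  case (Suc n)
  have "(LEAST w. j < height w N i) = Suc n" if "\<not> j < height n N i" "j < height (Suc n) N i"
  proof (rule Least_equality)
    show "Suc n \<le> w" if "j < height w N i" for w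
      using that height_mono[of w n N i] \<open>\<not> j < height n N i\<close> by (meson not_less_eq_eq less_le_trans)
  qed (rule that)
  then show ?case
    using Suc recording_iff_and_Suc[of n "(i, j)"] height_mono_Suc[of n N i]
    by (auto simp: boxes_tableau_iff)
qed

definition row_len :: "nat \<Rightarrow> nat" where
  "row_len j = card {i. j < height N N i}"

lemma less_row_len_iff: "i < row_len j \<longleftrightarrow> j < height N N i"
proof -
  have "{i. j < height N N i} \<subseteq> {..<length (tableau N)}"
    using height_eventually_0[of N] by (metis lessThan_iff mem_Collect_eq not_less not_less_zero subsetI)
  then have fin: "finite {i. j < height N N i}" by (rule finite_subset) simp
  have "i \<in> {i. j < height N N i} \<longleftrightarrow> i < card {i. j < height N N i}"
    by (rule mem_initial_segment_iff[OF fin]) (use height_antimono less_imp_le less_le_trans in blast)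
  then show ?thesis by (simp add: row_len_def)
qed

lemma column_recording_tableau:
  "column (columns_of (recording N)) j = map (\<lambda>i. LEAST w. j < height w N i) [0..<row_len j]"
proof -
  have dom: "(i, j) \<in> dom (recording N) \<longleftrightarrow> j < height N N i" for i j
    by (simp add: recording_eq dom_def)
  have "row_len j = 0" if "\<not> j < height N N 0"
    using that less_row_len_iff[of 0 j] by simp
  then show ?thesis
    by (auto simp: column_def columns_of_def dom row_len_def[symmetric] recording_eq less_row_len_iff)
qed

lemma entry_le_iff:
  assumes "i < row_len j"
  shows "(LEAST w. j < height w N i) \<le> k \<longleftrightarrow> j < height k N i"
proof
  assume "(LEAST w. j < height w N i) \<le> k"
  moreover have "j < height (LEAST w. j < height w N i) N i"
    using assms unfolding less_row_len_iff by (rule LeastI)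
  ultimately show "j < height k N i" using height_mono less_le_trans by blast
qed (rule Least_le)

lemma columns_in_recording_tableau: "columns_in N (columns_of (recording N))"
proof -
  let ?T = "columns_of (recording N)"
  have "c \<noteq> [] \<and> sorted_wrt (<) c \<and> set c \<subseteq> {1..N}" if c: "c \<in> set ?T" for c
  proof -
    obtain j where j: "j < length ?T" "c = ?T ! j" using c by (auto simp: in_set_conv_nth)
    then have c: "c = map (\<lambda>i. LEAST w. j < height w N i) [0..<row_len j]"
      using column_recording_tableau[of j] by (simp add: column_def)
    have "j < height N N 0"
      using j(1) by (simp add: columns_of_def recording_eq dom_def split: if_splits)
    then have "c \<noteq> []" using c less_row_len_iff[of 0 j] by simp
    moreover have "(LEAST w. j < height w N i) < (LEAST w. j < height w N i')"
      if i: "i < i'" "i' < row_len j" for i i'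
    proof -
      define w' where "w' = (LEAST w. j < height w N i')"
      have *: "j < height w' N i'" using entry_le_iff[OF i(2), of w'] by (simp add: w'_def)
      then obtain w where w: "w' = Suc w" by (cases w') auto
      obtain l where l: "i' = Suc l" "i \<le> l" using i(1) by (cases i') auto
      \<comment> \<open>The vertical strip condition: if column \<open>i'\<close> exceeds height
        \<open>j\<close> after step \<open>Suc w\<close>, the columns to its left did so already
        after step \<open>w\<close>.\<close>
      have "j < height w N i"
        using * height_decreasing_and_strip[of w N l] height_antimono[OF l(2), of w N]
        by (simp add: w l)
      then have "(LEAST w. j < height w N i) \<le> w" by (rule Least_le)
      then show ?thesis using w w'_def by simp
    qed
    then have "sorted_wrt (<) c" by (auto simp: c sorted_wrt_iff_nth_less)
    moreover have "(LEAST w. j < height w N i) \<in> {1..N}" if "i < row_len j" for i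
      using that entry_le_iff[OF that, of N] entry_le_iff[OF that, of 0]
      by (simp add: less_row_len_iff Suc_le_eq)
    then have "set c \<subseteq> {1..N}" by (auto simp: c)
    ultimately show ?thesis by blast
  qed
  then show ?thesis by (simp add: columns_in_def)
qed

text \<open>Identifies the recording tableau, up to transposition, with the side
  \<open>height k N\<close> of the grid.\<close>

lemma cnt_recording_tableau_iff:
  assumes "k \<le> N"
  shows "i < cnt (entry_set (columns_of (recording N)) j) k \<longleftrightarrow> j < height k N i"
proof -
  let ?c = "column (columns_of (recording N)) j"
  have c: "sorted_wrt (<) ?c" "set ?c \<subseteq> {1..N}"
    using columns_in_column[OF columns_in_recording_tableau] by auto
  have len: "length ?c = row_len j" by (simp add: column_recording_tableau)
  show ?thesis
  proof (cases "i < row_len j")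
    case True
    have "i < cnt (set ?c) k \<longleftrightarrow> ?c ! i \<le> k"
      by (rule nth_le_iff_less_cnt[symmetric]) (use c len True in auto)
    also have "?c ! i = (LEAST w. j < height w N i)"
      using True by (simp add: column_recording_tableau)
    finally show ?thesis using entry_le_iff[OF True] by simp
  next
    case False
    have "cnt (set ?c) k \<le> row_len j"
      using cnt_mono[OF assms, of "set ?c"] length_column[OF columns_in_recording_tableau, of j] len by simp
    moreover have "height k N i \<le> height N N i" by (rule height_mono[OF assms])
    ultimately show ?thesis using False less_row_len_iff[of i j] by linarith
  qed
qed

end

section \<open>Pairs of transposed shapes and injectivity\<close>

definition transposed_pairs :: "nat \<Rightarrow> (filling \<times> filling) set" where
  "transposed_pairs N =
     {(T, T'). semistandard N T \<and> semistandard N T' \<and> transposed_shapes T T'}"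

lemma eq_if_same_less: "(\<And>j. j < a \<longleftrightarrow> j < b) \<Longrightarrow> a = (b :: nat)"
  by (metis nat_neq_iff)

lemma (in knuth_run) knuth_in_transposed_pairs: "knuth N M \<in> transposed_pairs N"
proof -
  let ?T' = "columns_of (recording N)"
  have "cnt (entry_set ?T' (Suc j)) k \<le> cnt (entry_set ?T' j) k" for j k
  proof -
    have *: "cnt (entry_set ?T' (Suc j)) k \<le> cnt (entry_set ?T' j) k" if "k \<le> N" for k
      using cnt_recording_tableau_iff[OF that] by (meson Suc_lessD not_le order_refl)
    show ?thesis
    proof (cases "k \<le> N")
      case False
      then show ?thesis
        using *[of N] cnt_eq_card[OF columns_in_column(2)[OF columns_in_recording_tableau]] by simp
    qed (rule *)
  qed
  then have "semistandard N ?T'"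
    using columns_in_recording_tableau by (simp add: semistandard_def)
  moreover have "transposed_shapes (tableau N) ?T'"
    by (simp add: transposed_shapes_def length_column[OF columns_in_recording_tableau]
        cnt_recording_tableau_iff mem_boxes_iff[symmetric] boxes_tableau_iff)
  ultimately show ?thesis
    using semistandard_tableau by (simp add: transposed_pairs_def knuth_eq)
qed

lemma knuth_inj_on: "inj_on (knuth N) (zero_one_matrices N)"
proof (rule inj_onI)
  fix M M' assume M: "M \<in> zero_one_matrices N" "M' \<in> zero_one_matrices N"
    and eq: "knuth N M = knuth N M'"
  interpret A: knuth_run N M .
  interpret B: knuth_run N M' .
  have T: "B.tableau N = A.tableau N" "columns_of (B.recording N) = columns_of (A.recording N)"
    using eq by (simp_all add: A.knuth_eq B.knuth_eq)
  have top: "B.height N k = A.height N k" for k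
    by (simp add: A.height_def[abs_def] B.height_def[abs_def] T)
  have right: "B.height u N = A.height u N" if "u \<le> N" for u
    using A.cnt_recording_tableau_iff[OF that] B.cnt_recording_tableau_iff[OF that] T(2)
    by (intro ext eq_if_same_less) simp
  have backward: "B.height u k = A.height u k \<and>
      (Suc k \<le> N \<and> M' (Suc u, Suc k) = 1) = (Suc k \<le> N \<and> M (Suc u, Suc k) = 1)"
    if "B.height u (Suc k) = A.height u (Suc k)" "B.height (Suc u) k = A.height (Suc u) k"
      "B.height (Suc u) (Suc k) = A.height (Suc u) (Suc k)" for u k
    by (rule growth_backward_unique[OF A.growth_height[of u k] B.growth_height[of u k, unfolded that]
          A.height_eventually_0])
  \<comment> \<open>Both inductions descend from \<open>N\<close>, because a cell yields its corner
    \<open>(u, k)\<close> from the other three.\<close>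
  have heights: "B.height u k = A.height u k" if "u \<le> N" "k \<le> N" for u k
    using that
  proof (induction u arbitrary: k rule: inc_induct)
    case (step u)
    note IH = step.IH
    show ?case using step.prems
    proof (induction k rule: inc_induct)
      case (step k)
      then show ?case using backward[of u k] IH[of k] IH[of "Suc k"] by simp
    qed (use right \<open>u < N\<close> in simp)
  qed (rule top)
  show "M = M'"
  proof (rule PiE_ext)
    show "M \<in> ({1..N} \<times> {1..N}) \<rightarrow>\<^sub>E {0, 1}" "M' \<in> ({1..N} \<times> {1..N}) \<rightarrow>\<^sub>E {0, 1}"
      using M by (auto simp: zero_one_matrices_def)
    fix p assume p: "p \<in> {1..N} \<times> {1..N}"
    obtain u k where uk: "p = (Suc u, Suc k)" "u < N" "k < N"
    proof
      show "p = (Suc (fst p - 1), Suc (snd p - 1))" "fst p - 1 < N" "snd p - 1 < N"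
        using p by auto
    qed
    have "M p = 1 \<longleftrightarrow> M' p = 1"
      using backward[of u k] heights uk by simp
    moreover have "M p \<in> {0, 1}" "M' p \<in> {0, 1}"
      using M p by (auto simp: zero_one_matrices_def)
    ultimately show "M p = M' p" by auto
  qed
qed

section \<open>Surjectivity by filling the grid backwards\<close>

text \<open>The strip conditions are part of the choice because the following cells rely on
  them.\<close>

definition growth_predecessor :: "(nat \<Rightarrow> nat) \<Rightarrow> (nat \<Rightarrow> nat) \<Rightarrow> (nat \<Rightarrow> nat) \<Rightarrow> nat \<Rightarrow> nat" where
  "growth_predecessor \<mu> \<nu> \<kappa> = (SOME \<rho>. (\<exists>m. growth \<rho> \<mu> \<nu> m \<kappa>) \<and>
     (\<forall>j. \<nu> (Suc j) \<le> \<rho> j) \<and> (\<forall>j. \<mu> j = \<rho> j \<or> \<mu> j = Suc (\<rho> j)))"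

text \<open>Reconstruction from the final values: \<open>grid t r i l\<close> is the shape at \<open>(N - i, N - l)\<close>.\<close>

fun grid :: "(nat \<Rightarrow> nat \<Rightarrow> nat) \<Rightarrow> (nat \<Rightarrow> nat \<Rightarrow> nat) \<Rightarrow> nat \<Rightarrow> nat \<Rightarrow> nat \<Rightarrow> nat" where
  "grid t r 0 l = t l"
| "grid t r (Suc i) 0 = r (Suc i)"
| "grid t r (Suc i) (Suc l) =
     growth_predecessor (grid t r (Suc i) l) (grid t r i (Suc l)) (grid t r i l)"

text \<open>Vertical strips between rows \<open>i\<close> and \<open>Suc i\<close> propagate along
  \<open>l\<close>, starting from \<open>r\<close>; horizontal strips and weakly decreasing shapes
  pass from row \<open>i\<close> to row \<open>Suc i\<close>. The two bounds serve to make the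
  remaining sides of the grid empty.\<close>

lemma grid_growth:
  assumes t: "\<And>l j. t l (Suc j) \<le> t l j" "\<And>l j. t l j = t (Suc l) j \<or> t l j = Suc (t (Suc l) j)"
    and r: "\<And>i j. r (Suc i) j \<le> r i j" "\<And>i j. r i (Suc j) \<le> r (Suc i) j" and "t 0 = r 0"
  defines "B \<equiv> grid t r"
  shows "\<exists>m. growth (B (Suc i) (Suc l)) (B (Suc i) l) (B i (Suc l)) m (B i l)"
    and "B i l j \<le> t l j" and "B i l j \<le> r i j"
proof -
  have B0: "B i 0 = r i" for i using \<open>t 0 = r 0\<close> by (cases i) (auto simp: B_def)
  have row: "B i l (Suc j) \<le> B (Suc i) l j \<and> B (Suc i) l j \<le> B i l j \<and>
      (\<exists>m. growth (B (Suc i) (Suc l)) (B (Suc i) l) (B i (Suc l)) m (B i l)) \<and>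
      (B (Suc i) l j = B (Suc i) (Suc l) j \<or> B (Suc i) l j = Suc (B (Suc i) (Suc l) j))"
    if D: "\<And>l j. B i l (Suc j) \<le> B i l j"
      and H: "\<And>l j. B i l j = B i (Suc l) j \<or> B i l j = Suc (B i (Suc l) j)" for i l j
  proof -
    have step: "(\<exists>m. growth (B (Suc i) (Suc l)) (B (Suc i) l) (B i (Suc l)) m (B i l)) \<and>
        (\<forall>j. B i (Suc l) (Suc j) \<le> B (Suc i) (Suc l) j) \<and>
        (\<forall>j. B (Suc i) l j = B (Suc i) (Suc l) j \<or> B (Suc i) l j = Suc (B (Suc i) (Suc l) j))"
      if "\<And>j. B i l (Suc j) \<le> B (Suc i) l j" "\<And>j. B (Suc i) l j \<le> B i l j" for l
    proof -
      have "\<exists>\<rho>. (\<exists>m. growth \<rho> (B (Suc i) l) (B i (Suc l)) m (B i l)) \<and>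
          (\<forall>j. B i (Suc l) (Suc j) \<le> \<rho> j) \<and> (\<forall>j. B (Suc i) l j = \<rho> j \<or> B (Suc i) l j = Suc (\<rho> j))"
        using growth_backward_exists[of "B i l" "B i (Suc l)" "B (Suc i) l", OF H that(2,1) D] by blast
      from someI_ex[OF this] show ?thesis
        unfolding B_def grid.simps growth_predecessor_def .
    qed
    have "B i l (Suc j) \<le> B (Suc i) l j \<and> B (Suc i) l j \<le> B i l j" for l j
    proof (induction l arbitrary: j)
      case 0
      then show ?case using r by (simp add: B0)
    next
      case (Suc l)
      then show ?case using step[of l] growth_mono by blast
    qed
    then show ?thesis using step[of l] by blast
  qed
  have inv: "B i l (Suc j) \<le> B i l j \<and> (B i l j = B i (Suc l) j \<or> B i l j = Suc (B i (Suc l) j))" for i l j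
  proof (induction i arbitrary: l j)
    case 0
    then show ?case using t by (simp add: B_def)
  next
    case (Suc i)
    have D: "\<And>l j. B i l (Suc j) \<le> B i l j"
      and H: "\<And>l j. B i l j = B i (Suc l) j \<or> B i l j = Suc (B i (Suc l) j)"
      using Suc by auto
    show ?case
      using row[OF D H, of l j] row[OF D H, of l "Suc j"] by linarith
  qed
  show "\<exists>m. growth (B (Suc i) (Suc l)) (B (Suc i) l) (B i (Suc l)) m (B i l)"
    using row inv by blast
  have "B (Suc i) l j \<le> B i l j" for i using row inv by blast
  then show "B i l j \<le> t l j"
    using lift_Suc_antimono_le[of "\<lambda>i. B i l j" 0 i] by (simp add: B_def)
  have "B i (Suc l) j \<le> B i l j" for l using inv[of i l j] by linarith
  then show "B i l j \<le> r i j"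
    using lift_Suc_antimono_le[of "\<lambda>l. B i l j" 0 l] by (simp add: B0)
qed

lemma knuth_surj:
  assumes "(T, T') \<in> transposed_pairs N"
  shows "(T, T') \<in> knuth N ` zero_one_matrices N"
proof -
  have T: "columns_in N T" "\<And>j k. cnt (entry_set T (Suc j)) k \<le> cnt (entry_set T j) k"
    and T': "columns_in N T'" "\<And>j k. cnt (entry_set T' (Suc j)) k \<le> cnt (entry_set T' j) k"
    and tr: "\<And>i j. j < length (column T i) \<longleftrightarrow> i < length (column T' j)"
    using assms by (auto simp: transposed_pairs_def semistandard_def transposed_shapes_def)
  define t where "t k j = cnt (entry_set T j) k" for k j
  \<comment> \<open>The length of row \<open>i\<close> of the part of \<open>T'\<close> with entries
    at most \<open>u\<close>, hence the height that column \<open>i\<close> must have after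
    \<open>u\<close> matrix rows.\<close>
  define r where "r u i = card {j. i < cnt (entry_set T' j) u}" for u i
  have r_iff: "j < r u i \<longleftrightarrow> i < cnt (entry_set T' j) u" for u i j
  proof -
    have "{j. i < cnt (entry_set T' j) u} \<subseteq> {..<length T'}"
    proof
      fix j assume "j \<in> {j. i < cnt (entry_set T' j) u}"
      then have "column T' j \<noteq> []" by auto
      then show "j \<in> {..<length T'}" by (simp add: column_def split: if_splits)
    qed
    then have "finite {j. i < cnt (entry_set T' j) u}" by (rule finite_subset) simp
    moreover have "cnt (entry_set T' b) u \<le> cnt (entry_set T' a) u" if "a \<le> b" for a b
      by (rule lift_Suc_antimono_le[of "\<lambda>j. cnt (entry_set T' j) u", OF T'(2) that])
    then have "a \<in> {j. i < cnt (entry_set T' j) u}"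
      if "b \<in> {j. i < cnt (entry_set T' j) u}" "a < b" for a b
      using that less_le_trans less_imp_le by (metis (mono_tags, lifting) mem_Collect_eq)
    ultimately show ?thesis
      unfolding r_def using mem_initial_segment_iff[of "{j. i < cnt (entry_set T' j) u}" j] by blast
  qed
  have r_mono: "r u i \<le> r (Suc u) i" and r_strip: "r (Suc u) (Suc i) \<le> r u i" for u i
  proof -
    have "j < r (Suc u) i" if "j < r u i" for j
      using that by (simp add: r_iff cnt_Suc)
    then show "r u i \<le> r (Suc u) i" by (meson not_le order_refl)
    have "j < r u i" if "j < r (Suc u) (Suc i)" for j
      using that by (cases "Suc u \<in> entry_set T' j") (simp_all add: r_iff cnt_Suc)
    then show "r (Suc u) (Suc i) \<le> r u i" by (meson not_le order_refl)
  qed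
  have r0: "r 0 i = 0" for i by (simp add: r_def)
  have tr': "t N = r N"
    using tr by (intro ext eq_if_same_less)
      (simp add: t_def r_iff length_column[OF T(1)] length_column[OF T'(1)])
  define B where "B = grid (\<lambda>l. t (N - l)) (\<lambda>i. r (N - i))"
  \<comment> \<open>From \<open>N\<close> on the truncated difference stays 0 and both side
    sequences are constant, so the hypotheses of \<open>grid_growth\<close> hold for all
    indices.\<close>
  have diff_cases: "(n < N \<and> N - n = Suc (N - Suc n)) \<or> (N - n = 0 \<and> N - Suc n = 0)" for n
    by auto
  have 1: "t (N - l) (Suc j) \<le> t (N - l) j" for l j
    by (simp add: t_def T)
  have 2: "t (N - l) j = t (N - Suc l) j \<or> t (N - l) j = Suc (t (N - Suc l) j)" for l j
    using diff_cases[of l] cnt_Suc[of "entry_set T j" "N - Suc l"] by (auto simp: t_def)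
  have 3: "r (N - Suc i) j \<le> r (N - i) j" for i j
    using diff_cases[of i] r_mono[of "N - Suc i" j] by auto
  have 4: "r (N - i) (Suc j) \<le> r (N - Suc i) j" for i j
    using diff_cases[of i] r_strip[of "N - Suc i" j] r0 by auto
  note B = grid_growth[where t = "\<lambda>l. t (N - l)" and r = "\<lambda>i. r (N - i)", OF 1 2 3 4, folded B_def]
  have B_top: "B 0 l = t (N - l)" for l by (simp add: B_def)
  have B_right: "B i 0 = r (N - i)" for i using tr' by (cases i) (auto simp: B_def)
  have "\<forall>i l. \<exists>m. growth (B (Suc i) (Suc l)) (B (Suc i) l) (B i (Suc l)) m (B i l)"
    using B(1) tr' by simp
  then obtain m where m: "\<And>i l. growth (B (Suc i) (Suc l)) (B (Suc i) l) (B i (Suc l)) (m i l) (B i l)"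
    by metis
  define M :: "nat \<times> nat \<Rightarrow> nat" where "M = restrict (\<lambda>(u, k). of_bool (m (N - u) (N - k))) ({1..N} \<times> {1..N})"
  have M: "M \<in> zero_one_matrices N"
    unfolding M_def zero_one_matrices_def by (rule restrict_PiE_iff[THEN iffD2]) auto
  interpret knuth_run N M .
  \<comment> \<open>The bounds by \<open>r 0\<close> and \<open>t 0\<close> give empty shapes at
    \<open>u = 0\<close> and \<open>k = 0\<close>; from there forward uniqueness forces the run of
    \<open>M\<close> through the constructed shapes.\<close>
  have heights: "height u k = B (N - u) (N - k)" if "u \<le> N" "k \<le> N" for u k
    using that
  proof (induction u arbitrary: k)
    case 0
    have "B (N - 0) (N - k) j = 0" for j
      using B(3)[of N "N - k" j] tr' r0 by simp
    then show ?case by (auto intro: ext)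
  next
    case (Suc u)
    note IH = Suc.IH
    show ?case using \<open>k \<le> N\<close>
    proof (induction k)
      case 0
      have "B (N - Suc u) (N - 0) j = 0" for j
        using B(2)[of "N - Suc u" N j] tr' by (simp add: t_def)
      then show ?case by (auto intro: ext)
    next
      case (Suc k)
      have N: "N - u = Suc (N - Suc u)" "N - k = Suc (N - Suc k)"
        using Suc.prems \<open>Suc u \<le> N\<close> by auto
      have "(Suc k \<le> N \<and> M (Suc u, Suc k) = 1) = m (N - Suc u) (N - Suc k)"
        using Suc.prems \<open>Suc u \<le> N\<close> by (simp add: M_def)
      then have "growth (B (N - u) (N - k)) (B (N - u) (N - Suc k)) (B (N - Suc u) (N - k))
          (m (N - Suc u) (N - Suc k)) (height (Suc u) (Suc k))"
        using growth_height[of u k] IH[of k] IH[of "Suc k"] Suc \<open>Suc u \<le> N\<close> by simp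
      then show ?case
        using growth_forward_unique[OF m[of "N - Suc u" "N - Suc k"]] unfolding N by blast
    qed
  qed
  have "tableau N = T"
  proof (rule filling_eqI[OF columns_in_tableau T(1)])
    show "entry_set (tableau N) j = entry_set T j" for j
    proof (rule cnt_inject[OF columns_in_column(2)[OF columns_in_tableau] columns_in_column(2)[OF T(1)]])
      show "cnt (entry_set (tableau N) j) k = cnt (entry_set T j) k" if "k \<le> N" for k
        using heights[OF order_refl that] that by (simp add: height_def[abs_def] B_top t_def[abs_def] fun_eq_iff)
    qed
  qed
  moreover have "columns_of (recording N) = T'"
  proof (rule filling_eqI[OF columns_in_recording_tableau T'(1)])
    show "entry_set (columns_of (recording N)) j = entry_set T' j" for j
    proof (rule cnt_inject[OF columns_in_column(2)[OF columns_in_recording_tableau]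
          columns_in_column(2)[OF T'(1)]])
      show "cnt (entry_set (columns_of (recording N)) j) k = cnt (entry_set T' j) k" if "k \<le> N" for k
        using heights[OF that order_refl] that
        by (intro eq_if_same_less) (simp add: cnt_recording_tableau_iff B_right r_iff)
    qed
  qed
  ultimately show ?thesis
    using M by (intro image_eqI[of _ _ M]) (simp_all add: knuth_eq)
qed

lemma knuth_bij_betw: "bij_betw (knuth N) (zero_one_matrices N) (transposed_pairs N)"
  unfolding bij_betw_def
proof (intro conjI equalityI subsetI)
  show "p \<in> transposed_pairs N" if "p \<in> knuth N ` zero_one_matrices N" for p
    using that knuth_run.knuth_in_transposed_pairs by blast
  show "p \<in> knuth N ` zero_one_matrices N" if "p \<in> transposed_pairs N" for p
    using that knuth_surj[of "fst p" "snd p"] by simp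
qed (rule knuth_inj_on)

section \<open>Shapes\<close>

lemma row_length_antimono: "is_partition l \<Longrightarrow> i \<le> j \<Longrightarrow> row_length l j \<le> row_length l i"
  by (cases "i = j") (auto simp: is_partition_def row_length_def sorted_wrt_iff_nth_less)

lemma row_length_inject:
  "0 \<notin> set l \<Longrightarrow> 0 \<notin> set l' \<Longrightarrow> (\<And>i. row_length l i = row_length l' i) \<Longrightarrow> l = l'"
  by (rule padded_list_eqI[of l 0 l']) (auto simp: row_length_def)

lemma zero_not_in_partition: "is_partition l \<Longrightarrow> 0 \<notin> set l"
  by (auto simp: is_partition_def)

lemma row_length_conjugate: "row_length (conjugate l) j = length (filter (\<lambda>p. j < p) l)"
proof (cases "j < Max (insert 0 (set l))")
  case False
  then have "p \<le> j" if "p \<in> set l" for p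
    using that Max_ge[of "insert 0 (set l)" p] by (meson List.finite_set finite.insertI insertI2 le_trans not_le)
  then have "filter (\<lambda>p. j < p) l = []" by (auto simp: filter_empty_conv not_less)
  then show ?thesis using False by (simp add: row_length_def conjugate_def)
qed (simp add: row_length_def conjugate_def)

text \<open>Conjugation transposes the diagram: as row lengths decrease weakly, the rows longer than
  \<open>j\<close> form an initial segment.\<close>

lemma less_row_length_conjugate_iff:
  assumes "is_partition l"
  shows "i < row_length (conjugate l) j \<longleftrightarrow> j < row_length l i"
proof -
  let ?S = "{i. i < length l \<and> j < l ! i}"
  have S: "i \<in> ?S \<longleftrightarrow> j < row_length l i" for i
    by (simp add: row_length_def)
  have "i \<in> ?S \<longleftrightarrow> i < card ?S"
  proof (rule mem_initial_segment_iff)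
    show "a \<in> ?S" if "b \<in> ?S" "a < b" for a b
      using that row_length_antimono[OF assms, of a b] unfolding S by linarith
  qed simp
  then show ?thesis
    unfolding S by (simp add: row_length_conjugate length_filter_conv_card)
qed

lemma is_partition_conjugate: "is_partition (conjugate l)"
  unfolding is_partition_def
proof
  have "length (filter (\<lambda>p. j < p) l) \<le> length (filter (\<lambda>p. i < p) l)" if "i < j" for i j
    unfolding length_filter_conv_card using that by (intro card_mono) auto
  then show "sorted_wrt (\<ge>) (conjugate l)"
    by (auto simp: conjugate_def sorted_wrt_iff_nth_less)
  show "\<forall>p\<in>set (conjugate l). 0 < p"
    by (auto simp: conjugate_def filter_empty_conv Max_gr_iff)
qed

lemma conjugate_conjugate: "is_partition l \<Longrightarrow> conjugate (conjugate l) = l"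
  by (intro row_length_inject eq_if_same_less)
    (simp_all add: is_partition_conjugate zero_not_in_partition less_row_length_conjugate_iff)

lemma row_length_map_length: "row_length (map length T) i = length (column T i)"
  by (simp add: row_length_def column_def)

lemma zero_not_in_map_length: "columns_in N T \<Longrightarrow> 0 \<notin> set (map length T)"
  by (auto simp: columns_in_def)

lemma cnt_le_length:
  "sorted_wrt (<) c \<Longrightarrow> cnt (set c) k \<le> length c"
  unfolding cnt_def by (metis List.finite_set card_length card_mono inf_le1 le_trans)

text \<open>Evaluating the counts at \<open>N\<close> compares lengths, and evaluating them at
  \<open>b ! i\<close> compares the entries in row \<open>i\<close>.\<close>

lemma cnt_le_cnt_iff:
  assumes a: "sorted_wrt (<) a" "set a \<subseteq> {1..N}" and b: "sorted_wrt (<) b" "set b \<subseteq> {1..N}"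
  shows "(\<forall>k. cnt (set b) k \<le> cnt (set a) k) \<longleftrightarrow>
    length b \<le> length a \<and> (\<forall>i<length b. a ! i \<le> b ! i)" (is "?L \<longleftrightarrow> ?R")
proof -
  have pos: "\<forall>x\<in>set a. 0 < x" "\<forall>x\<in>set b. 0 < x" using a b by auto
  note le_a = nth_le_iff_less_cnt[OF a(1) pos(1)] and le_b = nth_le_iff_less_cnt[OF b(1) pos(2)]
  show ?thesis
  proof
    assume L: ?L
    have "length b \<le> length a"
      using L[rule_format, of N] a b by (simp add: cnt_eq_card distinct_card strict_sorted_iff)
    moreover have "a ! i \<le> b ! i" if "i < length b" for i
      using L[rule_format, of "b ! i"] le_b[OF that, of "b ! i"] le_a[of i "b ! i"] that calculation
      by simp
    ultimately show ?R by blast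
  next
    assume R: ?R
    have "i < cnt (set a) k" if i: "i < cnt (set b) k" for i k
    proof -
      have "i < length b" using i cnt_le_length[OF b(1), of k] by simp
      then show ?thesis
        using i R le_b[of i k] le_a[of i k] by (meson less_le_trans order_trans)
    qed
    then show ?L by (meson not_le order_refl)
  qed
qed

text \<open>\<open>young_tableau\<close> compares all pairs of columns and
  \<open>semistandard\<close> only adjacent ones; transitivity of dominance closes the gap.\<close>

lemma young_tableau_iff:
  "young_tableau l T \<and> entries T \<subseteq> {1..N} \<longleftrightarrow>
     is_partition l \<and> map length T = conjugate l \<and> semistandard N T"
proof
  assume Y: "young_tableau l T \<and> entries T \<subseteq> {1..N}"
  then have l: "is_partition l" "map length T = conjugate l"
    and rows: "\<And>j k i. j < k \<Longrightarrow> k < length T \<Longrightarrow> i < length (T ! k) \<Longrightarrow> T ! j ! i \<le> T ! k ! i"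
    by (auto simp: young_tableau_def)
  have "length c \<in> set (map length T)" if "c \<in> set T" for c using that by simp
  then have "c \<noteq> []" if "c \<in> set T" for c
    using that is_partition_conjugate[of l] unfolding l(2) is_partition_def by fastforce
  then have cols: "columns_in N T"
    using Y by (auto simp: columns_in_def young_tableau_def entries_def)
  have "\<forall>k. cnt (entry_set T (Suc j)) k \<le> cnt (entry_set T j) k" for j
  proof (subst cnt_le_cnt_iff[OF columns_in_column[OF cols] columns_in_column[OF cols]], intro conjI allI impI)
    show len: "length (column T (Suc j)) \<le> length (column T j)"
      using row_length_antimono[OF is_partition_conjugate[of l], of j "Suc j"]
      by (simp flip: l(2) add: row_length_map_length)
    show "column T j ! i \<le> column T (Suc j) ! i" if "i < length (column T (Suc j))" for i
      using that rows[of j "Suc j" i] by (auto simp: column_def split: if_splits)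
  qed
  then show "is_partition l \<and> map length T = conjugate l \<and> semistandard N T"
    using l cols by (auto simp: semistandard_def)
next
  assume R: "is_partition l \<and> map length T = conjugate l \<and> semistandard N T"
  then have cols: "columns_in N T"
    and cnt: "\<And>j k. cnt (entry_set T (Suc j)) k \<le> cnt (entry_set T j) k"
    by (auto simp: semistandard_def)
  have "T ! j ! i \<le> T ! k ! i" if "j < k" "k < length T" "i < length (T ! k)" for i j k
  proof -
    have "\<forall>l. cnt (entry_set T k) l \<le> cnt (entry_set T j) l"
      using lift_Suc_antimono_le[of "\<lambda>j. cnt (entry_set T j) _"] cnt that(1) by (simp add: less_imp_le)
    then show ?thesis
      using that cnt_le_cnt_iff[OF columns_in_column[OF cols] columns_in_column[OF cols], of k j]
      by (simp add: column_def)
  qed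
  moreover have "\<forall>c\<in>set T. \<forall>x\<in>set c. 0 < x" "\<forall>c\<in>set T. sorted_wrt (<) c" "entries T \<subseteq> {1..N}"
  proof -
    have c: "sorted_wrt (<) c" "set c \<subseteq> {1..N}" if "c \<in> set T" for c
      using cols that by (auto simp: columns_in_def)
    show "\<forall>c\<in>set T. \<forall>x\<in>set c. 0 < x" using c(2) by force
    show "\<forall>c\<in>set T. sorted_wrt (<) c" using c(1) by blast
    show "entries T \<subseteq> {1..N}" unfolding entries_def using c(2) by blast
  qed
  ultimately show "young_tableau l T \<and> entries T \<subseteq> {1..N}"
    using R unfolding young_tableau_def by blast
qed

section \<open>Complements\<close>

text \<open>Once \<open>f\<close> reaches \<open>z\<close> it keeps this value, so filtering cuts
  off a tail and shifts no index.\<close>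

lemma nth_filter_map_upt:
  assumes "\<forall>j. Suc j < N \<longrightarrow> f j = z \<longrightarrow> f (Suc j) = z"
  defines "xs \<equiv> filter (\<lambda>x. x \<noteq> z) (map f [0..<N])"
  shows "(if i < length xs then xs ! i else z) = (if i < N then f i else z)"
  using assms(1) unfolding xs_def
proof (induction N)
  case (Suc N)
  show ?case
  proof (cases "f N = z")
    case True
    then show ?thesis using Suc by (auto simp: less_Suc_eq)
  next
    case False
    have "f j \<noteq> z" if "j \<le> N" for j
      using that
    proof (induction j rule: inc_induct)
      case (step j)
      then show ?case using Suc.prems by auto
    qed (rule False)
    then have "filter (\<lambda>x. x \<noteq> z) (map f [0..<Suc N]) = map f [0..<Suc N]"
      by (intro filter_True) auto
    then show ?thesis by (auto simp del: upt_Suc)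
  qed
qed simp

text \<open>An empty complement comes from a full column. Dominance at \<open>N\<close> makes the
  column to its left full as well, so the empty complements are all at the right end.\<close>

lemma column_complement_column:
  assumes "semistandard N T"
  shows "column (column_complement N T) j =
    (if j < N then sorted_list_of_set ({1..N} - entry_set T (N - 1 - j)) else [])"
proof -
  let ?f = "\<lambda>j. sorted_list_of_set ({1..N} - entry_set T (N - 1 - j))"
  have sub: "entry_set T j \<subseteq> {1..N}" for j
    using assms columns_in_column by (auto simp: semistandard_def)
  have "?f (Suc j) = []" if "Suc j < N" "?f j = []" for j
  proof -
    have "{1..N} = entry_set T (N - 1 - j)" using that(2) sub by auto
    then have "N = cnt (entry_set T (N - 1 - j)) N" by (metis cnt_eq_card card_atLeastAtMost diff_Suc_1 order_refl)
    also have "N - 1 - j = Suc (N - 1 - Suc j)" using that(1) by simp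
    also have "cnt (entry_set T (Suc (N - 1 - Suc j))) N \<le> cnt (entry_set T (N - 1 - Suc j)) N"
      using assms by (simp add: semistandard_def)
    finally have "N \<le> card (entry_set T (N - 1 - Suc j))"
      by (simp add: cnt_eq_card[OF sub])
    then have "entry_set T (N - 1 - Suc j) = {1..N}"
      by (intro card_seteq) (use sub in auto)
    then show ?thesis by simp
  qed
  then have "\<forall>j. Suc j < N \<longrightarrow> ?f j = [] \<longrightarrow> ?f (Suc j) = []" by blast
  from nth_filter_map_upt[of N ?f "[]", OF this, of j] show ?thesis
    unfolding column_def[of "column_complement N T" j] unfolding column_complement_def .
qed

lemma entry_set_column_complement:
  "semistandard N T \<Longrightarrow> entry_set (column_complement N T) j =
    (if j < N then {1..N} - entry_set T (N - 1 - j) else {})"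
  by (auto simp: column_complement_column)

lemma length_column_complement_column:
  assumes "semistandard N T"
  shows "length (column (column_complement N T) j) =
    (if j < N then N - length (column T (N - 1 - j)) else 0)"
proof -
  have "columns_in N T" using assms by (simp add: semistandard_def)
  note * = length_column[OF this] columns_in_column(2)[OF this]
  show ?thesis
    using *(2)[of "N - 1 - j"] by (simp add: column_complement_column[OF assms] *(1) cnt_eq_card card_Diff_subset)
qed

lemma semistandard_column_complement:
  assumes "semistandard N T"
  shows "semistandard N (column_complement N T)"
proof -
  have cols: "columns_in N (column_complement N T)"
    by (auto simp: columns_in_def column_complement_def)
  \<comment> \<open>\<open>cnt_complement\<close> is confined to \<open>k \<le> N\<close>; beyond
    \<open>N\<close> all counts are constant.\<close>
  have le: "cnt (entry_set (column_complement N T) (Suc j)) k \<le> cnt (entry_set (column_complement N T) j) k"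
    if "k \<le> N" for j k
  proof (cases "Suc j < N")
    case True
    then have "N - 1 - j = Suc (N - 1 - Suc j)" by simp
    moreover have "cnt (entry_set T (Suc (N - 1 - Suc j))) k \<le> cnt (entry_set T (N - 1 - Suc j)) k"
      using assms by (simp add: semistandard_def)
    ultimately show ?thesis
      using True by (simp add: entry_set_column_complement[OF assms] cnt_complement[OF that]
          diff_le_mono2 del: One_nat_def)
  qed (simp add: entry_set_column_complement[OF assms])
  have "cnt (entry_set (column_complement N T) (Suc j)) k \<le> cnt (entry_set (column_complement N T) j) k" for j k
  proof (cases "k \<le> N")
    case False
    then show ?thesis using le[of N j] cnt_eq_card[OF columns_in_column(2)[OF cols]] by simp
  qed (rule le)
  then show ?thesis using cols by (simp add: semistandard_def)
qed

text \<open>The bound on \<open>length T\<close> excludes columns outside the square, which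
  complementation would lose.\<close>

lemma column_complement_involution:
  assumes "semistandard N T" "length T \<le> N"
  shows "column_complement N (column_complement N T) = T"
proof -
  note T = assms(1)[unfolded semistandard_def, THEN conjunct1]
  note TT = semistandard_column_complement[OF assms(1)]
  show ?thesis
  proof (rule filling_eqI[OF _ T])
    show "columns_in N (column_complement N (column_complement N T))"
      using semistandard_column_complement[OF TT] by (simp add: semistandard_def)
    show "entry_set (column_complement N (column_complement N T)) j = entry_set T j" for j
    proof (cases "j < N")
      case True
      then have "N - 1 - (N - 1 - j) = j" by simp
      then show ?thesis
        using True columns_in_column(2)[OF T, of j]
        by (auto simp: entry_set_column_complement[OF assms(1)] entry_set_column_complement[OF TT])
    next
      case False
      then have "column T j = []" using assms(2) by (simp add: column_def)
      then show ?thesis using False by (simp add: entry_set_column_complement[OF TT])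
    qed
  qed
qed

section \<open>Complementary shapes and the second bijection\<close>

text \<open>\<open>complementary\<close> is itself a conjugate, so the two conjugations cancel and
  its column heights are the differences \<open>N - row_length l (N - 1 - i)\<close>.\<close>

lemma young_tableau_complementary_iff:
  assumes "is_partition l"
  shows "young_tableau (complementary N l) T \<and> entries T \<subseteq> {1..N} \<longleftrightarrow>
    semistandard N T \<and> (\<forall>i. length (column T i) = (if i < N then N - row_length l (N - 1 - i) else 0))"
proof -
  let ?f = "\<lambda>i. N - row_length l (N - 1 - i)"
  define \<nu> where "\<nu> = filter (\<lambda>p. p \<noteq> 0) (map ?f [0..<N])"
  have anti: "?f j \<le> ?f i" if "i \<le> j" for i j
    using that by (intro diff_le_mono2 row_length_antimono assms) auto
  have "sorted_wrt (\<ge>) (map ?f [0..<N])"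
    using anti by (auto simp: sorted_wrt_iff_nth_less)
  then have \<nu>: "is_partition \<nu>"
    unfolding \<nu>_def is_partition_def by (auto intro: sorted_wrt_filter)
  have row: "row_length \<nu> i = (if i < N then ?f i else 0)" for i
  proof -
    have "\<forall>j. Suc j < N \<longrightarrow> ?f j = 0 \<longrightarrow> ?f (Suc j) = 0"
      using anti le_SucI order_refl le_zero_eq by metis
    from nth_filter_map_upt[of N ?f 0, OF this, of i] show ?thesis
      unfolding row_length_def[of \<nu> i] unfolding \<nu>_def .
  qed
  have "map length T = \<nu> \<longleftrightarrow> (\<forall>i. length (column T i) = row_length \<nu> i)"
    if "semistandard N T"
  proof
    assume R: "\<forall>i. length (column T i) = row_length \<nu> i"
    show "map length T = \<nu>"
      using R that zero_not_in_map_length[of N T] zero_not_in_partition[OF \<nu>]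
      by (intro row_length_inject) (auto simp: row_length_map_length semistandard_def)
  qed (simp flip: row_length_map_length)
  then have "semistandard N T \<Longrightarrow> map length T = \<nu> \<longleftrightarrow>
      (\<forall>i. length (column T i) = (if i < N then ?f i else 0))"
    unfolding row .
  then show ?thesis
    unfolding young_tableau_iff complementary_def \<nu>_def[symmetric] conjugate_conjugate[OF \<nu>]
    using is_partition_conjugate by blast
qed

lemma map_length_eq_conjugate_iff:
  assumes "is_partition l" "columns_in N T"
  shows "map length T = conjugate l \<longleftrightarrow> (\<forall>i j. j < length (column T i) \<longleftrightarrow> i < row_length l j)"
proof
  assume R: "\<forall>i j. j < length (column T i) \<longleftrightarrow> i < row_length l j"
  then have "length (column T i) = row_length (conjugate l) i" for i
    by (intro eq_if_same_less) (simp add: less_row_length_conjugate_iff[OF assms(1)])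
  then show "map length T = conjugate l"
    using zero_not_in_map_length[OF assms(2)] zero_not_in_partition[OF is_partition_conjugate]
    by (intro row_length_inject) (auto simp: row_length_map_length)
next
  assume "map length T = conjugate l"
  then show "\<forall>i j. j < length (column T i) \<longleftrightarrow> i < row_length l j"
    by (simp flip: row_length_map_length add: less_row_length_conjugate_iff[OF assms(1)])
qed

text \<open>With all conjugates eliminated, matching the shapes becomes arithmetic on column and row
  lengths.\<close>

lemma mem_tableau_pairs_iff:
  "(T, T') \<in> tableau_pairs N \<longleftrightarrow> semistandard N T \<and> semistandard N T' \<and>
     (\<exists>l. is_partition l \<and> fits_in_square N l \<and>
        (\<forall>i j. j < length (column T i) \<longleftrightarrow> i < row_length l j) \<and>
        (\<forall>i. length (column T' i) = (if i < N then N - row_length l (N - 1 - i) else 0)))"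
proof -
  have "(T, T') \<in> tableau_pairs N \<longleftrightarrow> (\<exists>l. fits_in_square N l \<and> is_partition l \<and>
      (young_tableau l T \<and> entries T \<subseteq> {1..N}) \<and>
      (young_tableau (complementary N l) T' \<and> entries T' \<subseteq> {1..N}))"
    by (auto simp: tableau_pairs_def young_tableau_def)
  also have "\<dots> \<longleftrightarrow> semistandard N T \<and> semistandard N T' \<and>
     (\<exists>l. is_partition l \<and> fits_in_square N l \<and>
        (\<forall>i j. j < length (column T i) \<longleftrightarrow> i < row_length l j) \<and>
        (\<forall>i. length (column T' i) = (if i < N then N - row_length l (N - 1 - i) else 0)))"
    using young_tableau_complementary_iff map_length_eq_conjugate_iff
    by (smt (verit) semistandard_def young_tableau_iff)
  finally show ?thesis .
qed

lemma semistandard_length_le: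
  assumes "semistandard N T" "column T N = []"
  shows "length T \<le> N"
proof (rule ccontr)
  assume "\<not> length T \<le> N"
  then have "T ! N \<in> set T" by simp
  moreover have "T ! N = []" using assms(2) \<open>\<not> length T \<le> N\<close> by (simp add: column_def)
  ultimately show False using assms(1) unfolding semistandard_def columns_in_def by metis
qed

lemma complement_bij_betw:
  "bij_betw (\<lambda>(T, S). (T, column_complement N S)) (transposed_pairs N) (tableau_pairs N)"
proof (rule bij_betw_byWitness[where f' = "\<lambda>(T, S). (T, column_complement N S)"])
  have len: "length (column T j) \<le> N" if "semistandard N T" for T j
    using that length_column[of N T j] unfolding cnt_def semistandard_def
    by (metis Int_lower2 card_atLeastAtMost card_mono diff_Suc_1 finite_atLeastAtMost)
  have 1: "length S \<le> N \<and> (T, column_complement N S) \<in> tableau_pairs N"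
    if "(T, S) \<in> transposed_pairs N" for T S
  proof -
    have T: "semistandard N T" and S: "semistandard N S"
      and tr: "\<And>i j. j < length (column T i) \<longleftrightarrow> i < length (column S j)"
      using that by (auto simp: transposed_pairs_def transposed_shapes_def)
    \<comment> \<open>The first column of \<open>T\<close> has at most \<open>N\<close> entries, so
      by transposition \<open>S\<close> has at most \<open>N\<close> columns.\<close>
    have "column S N = []" using tr[of N 0] len[OF T, of 0] by simp
    then have lS: "length S \<le> N" by (rule semistandard_length_le[OF S])
    have dec: "length (column S j) \<le> length (column S i)" if "i \<le> j" for i j
      using tr by (metis dual_order.strict_trans2 less_imp_le_nat linorder_not_le order_refl that)
    \<comment> \<open>This list is the shape of \<open>T\<close>: the column lengths of
      \<open>S\<close> are the row lengths of \<open>T\<close>.\<close>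
    have "is_partition (map length S)"
    proof -
      have "length (S ! j) \<le> length (S ! i)" if "i < j" "j < length S" for i j
        using dec[of i j] that by (simp add: column_def)
      then show ?thesis
        using S by (auto simp: is_partition_def sorted_wrt_iff_nth_less semistandard_def columns_in_def)
    qed
    moreover have "fits_in_square N (map length S)"
    proof -
      have "length (S ! j) \<le> N" if "j < length S" for j
        using len[OF S, of j] that by (simp add: column_def)
      then show ?thesis
        using lS by (auto simp: fits_in_square_def in_set_conv_nth)
    qed
    ultimately have "(T, column_complement N S) \<in> tableau_pairs N"
      unfolding mem_tableau_pairs_iff
      using T semistandard_column_complement[OF S]
      by (intro conjI exI[of _ "map length S"])
        (auto simp: row_length_map_length tr length_column_complement_column[OF S])
    then show ?thesis using lS by blast
  qed
  have 2: "length S \<le> N \<and> (T, column_complement N S) \<in> transposed_pairs N"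
    if "(T, S) \<in> tableau_pairs N" for T S
  proof -
    obtain l where T: "semistandard N T" and S: "semistandard N S" and l: "fits_in_square N l"
      and Tl: "\<And>i j. j < length (column T i) \<longleftrightarrow> i < row_length l j"
      and Sl: "\<And>i. length (column S i) = (if i < N then N - row_length l (N - 1 - i) else 0)"
      using \<open>(T, S) \<in> tableau_pairs N\<close> unfolding mem_tableau_pairs_iff by blast
    have "column S N = []" using Sl[of N] by simp
    then have lS: "length S \<le> N" by (rule semistandard_length_le[OF S])
    have "length (column (column_complement N S) j) = row_length l j" for j
    proof (cases "j < N")
      case True
      moreover have "N - 1 - (N - 1 - j) = j" using True by simp
      \<comment> \<open>Needed for \<open>N - (N - row_length l j)\<close> to give back
        \<open>row_length l j\<close> under truncated subtraction.\<close>
      moreover have "row_length l j \<le> N" using l by (auto simp: row_length_def fits_in_square_def)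
      ultimately show ?thesis
        by (simp add: length_column_complement_column[OF S] Sl)
    next
      case False
      then show ?thesis
        using l by (simp add: length_column_complement_column[OF S] row_length_def fits_in_square_def)
    qed
    then show ?thesis
      using lS T semistandard_column_complement[OF S] Tl
      by (simp add: transposed_pairs_def transposed_shapes_def)
  qed
  show "\<forall>p\<in>transposed_pairs N. (case case p of (T, S) \<Rightarrow> (T, column_complement N S) of
      (T, S) \<Rightarrow> (T, column_complement N S)) = p"
    using 1 column_complement_involution by (auto simp: transposed_pairs_def)
  show "\<forall>p\<in>tableau_pairs N. (case case p of (T, S) \<Rightarrow> (T, column_complement N S) of
      (T, S) \<Rightarrow> (T, column_complement N S)) = p"
  proof
    fix p assume p: "p \<in> tableau_pairs N"
    obtain T S where TS: "p = (T, S)" by force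
    then have "semistandard N S" "length S \<le> N"
      using p 2[of T S] by (simp_all add: mem_tableau_pairs_iff)
    then show "(case case p of (T, S) \<Rightarrow> (T, column_complement N S) of
        (T, S) \<Rightarrow> (T, column_complement N S)) = p"
      by (simp add: TS column_complement_involution)
  qed
  show "(\<lambda>(T, S). (T, column_complement N S)) ` transposed_pairs N \<subseteq> tableau_pairs N"
    using 1 by auto
  show "(\<lambda>(T, S). (T, column_complement N S)) ` tableau_pairs N \<subseteq> transposed_pairs N"
    using 2 by auto
qed

theorem mainTheorem1:
  fixes N :: nat
  assumes "N \<ge> 1"
  shows "bij_betw (Phi N) (zero_one_matrices N) (tableau_pairs N) \<and>
         card (tableau_pairs N) = 2 ^ (N ^ 2)"
proof -
  have "Phi N = (\<lambda>(T, S). (T, column_complement N S)) \<circ> knuth N"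
    by (auto simp: Phi_def fun_eq_iff)
  then have bij: "bij_betw (Phi N) (zero_one_matrices N) (tableau_pairs N)"
    using bij_betw_trans[OF knuth_bij_betw complement_bij_betw] by simp
  have "card (zero_one_matrices N) = 2 ^ (N ^ 2)"
    by (simp add: zero_one_matrices_def card_PiE power2_eq_square numeral_2_eq_2)
  then show ?thesis using bij bij_betw_same_card by metis
qed

end
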